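(* There exist two functions $f_m,f_M:\{(s,t)\in\mathbb{Z}^2: s,t\ge 3\}\to\mathbb{R}$ such that: (a) for all integers $s,t\ge3$, $p\ge1$, if $p\le f_m(s,t)$ then $\mathcal{R}(s,t,p)$ satisfies (FED), and if $p>f_M(s,t)$ then $\mathcal{R}(s,t,p)$ does not satisfy (FED); (b) $f_m(s,s)=f_M(s,s)$ for every integer $s\ge3$, and $f_m(s,s)\sim \frac{4}{\pi^2}s^2$ as $s\to+\infty$; (c) for every integer $s\ge 3$, $\sup_{t} f_M(s,t)<+\infty$.
   Context: For a finite simple graph $G$ with adjacency matrix $A$ and diagonal degree matrix $D$, the Laplacian is $L(G)=D-A$; the algebraic connectivity $\alpha(G)$ is its second smallest eigenvalue and a Fiedler vector is an eigenvector for $\alpha(G)$. A graph $G$ whose Fiedler vector $\Phi$ is unique up to a multiplicative constant satisfies property (FED) iff (i) the minimum and the maximum of $\Phi$ are each attained at a single vertex, $m$ and $M$, and (ii) the graph distance between $m$ and $M$ equals the diameter of $G$. The Rose tree $\mathcal{R}(s,t,p)$ has vertices $1,\dots,s+t+1$, $c=s+t+2$, $c+1,\dots,c+p$, and edges $\{i,i+1\}$ ($1\le i\le s+t$), $\{s+1,c\}$, $\{c,c+j\}$ ($1\le j\le p$). (It is known that for $s,t\ge 3$ its Fiedler vector is unique up to scaling.) *)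

theory Defs
  imports
    "Graph_Theory.Graph_Theory"
    "Jordan_Normal_Form.Char_Poly"
    "HOL-Library.Landau_Symbols"
begin

text \<open>
  A finite simple graph is a \<^locale>\<open>pair_graph\<close>: a finite loop-free digraph with a
  symmetric set of arcs, every undirected edge being represented by its two orientations.
  Its matrices are indexed from \<open>0\<close>; row and column \<open>i\<close> belong to the
  \<open>i\<close>-th smallest vertex \<open>vertex_list G ! i\<close>.
\<close>

definition vertex_list :: "'a::linorder pair_pre_digraph \<Rightarrow> 'a list" where
  "vertex_list G = sorted_list_of_set (pverts G)"

definition adjacency_matrix :: "'a::linorder pair_pre_digraph \<Rightarrow> real mat" where
  "adjacency_matrix G = mat (card (pverts G)) (card (pverts G))
     (\<lambda>(i, j). if (vertex_list G ! i, vertex_list G ! j) \<in> parcs G then 1 else 0)"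

text \<open>In a symmetric digraph the number of outgoing arcs is the degree of the undirected graph.\<close>

definition degree_matrix :: "'a::linorder pair_pre_digraph \<Rightarrow> real mat" where
  "degree_matrix G = mat (card (pverts G)) (card (pverts G))
     (\<lambda>(i, j). if i = j then real (out_degree (with_proj G) (vertex_list G ! i)) else 0)"

definition laplacian :: "'a::linorder pair_pre_digraph \<Rightarrow> real mat" where
  "laplacian G = degree_matrix G - adjacency_matrix G"

text \<open>
  Eigenvalues are listed in increasing order with multiplicity. The Laplacian is real symmetric,
  so all its eigenvalues occur among the real roots of the characteristic polynomial, and algebraic
  and geometric multiplicities agree. Meaningful for graphs with at least two vertices.
\<close>

definition algebraic_connectivity :: "'a::linorder pair_pre_digraph \<Rightarrow> real" where
  "algebraic_connectivity G = sorted_list_of_multiset (proots (char_poly (laplacian G))) ! 1"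

definition fiedler_vector :: "'a::linorder pair_pre_digraph \<Rightarrow> real vec \<Rightarrow> bool" where
  "fiedler_vector G \<Phi> \<longleftrightarrow> eigenvector (laplacian G) \<Phi> (algebraic_connectivity G)"

definition fiedler_vector_unique :: "'a::linorder pair_pre_digraph \<Rightarrow> bool" where
  "fiedler_vector_unique G \<longleftrightarrow>
     (\<exists>\<Phi>. fiedler_vector G \<Phi> \<and> (\<forall>\<Psi>. fiedler_vector G \<Psi> \<longrightarrow> (\<exists>k. \<Psi> = k \<cdot>\<^sub>v \<Phi>)))"

text \<open>Minimal number of arcs of a walk between two vertices (infinite if there is none).\<close>

definition graph_distance :: "'a pair_pre_digraph \<Rightarrow> 'a \<Rightarrow> 'a \<Rightarrow> ereal" where
  "graph_distance G u v = wf_digraph.\<mu> (with_proj G) (\<lambda>_. 1) u v"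

definition graph_diameter :: "'a pair_pre_digraph \<Rightarrow> ereal" where
  "graph_diameter G = (SUP (u, v) \<in> pverts G \<times> pverts G. graph_distance G u v)"

text \<open>
  The property is only meant for graphs whose Fiedler vector is unique up to a multiplicative
  constant, hence the first conjunct. It does not depend on the representative: positive multiples
  have the same extremal vertices and negative multiples exchange \<open>m\<close> and \<open>M\<close>.
\<close>

definition FED :: "'a::linorder pair_pre_digraph \<Rightarrow> bool" where
  "FED G \<longleftrightarrow> fiedler_vector_unique G \<and>
     (\<exists>\<Phi> m M. fiedler_vector G \<Phi> \<and>
        {i. is_arg_min (\<lambda>i. \<Phi> $ i) (\<lambda>i. i < card (pverts G)) i} = {m} \<and>
        {i. is_arg_max (\<lambda>i. \<Phi> $ i) (\<lambda>i. i < card (pverts G)) i} = {M} \<and>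
        graph_distance G (vertex_list G ! m) (vertex_list G ! M) = graph_diameter G)"

definition rose_edges :: "nat \<Rightarrow> nat \<Rightarrow> nat \<Rightarrow> (nat \<times> nat) set" where
  "rose_edges s t p = (let c = s + t + 2 in
     {(i, i + 1) | i. 1 \<le> i \<and> i \<le> s + t} \<union> {(s + 1, c)} \<union> {(c, c + j) | j. 1 \<le> j \<and> j \<le> p})"

definition rose_tree :: "nat \<Rightarrow> nat \<Rightarrow> nat \<Rightarrow> nat pair_pre_digraph" where
  "rose_tree s t p =
     \<lparr> pverts = {1..s + t + 2 + p}, parcs = rose_edges s t p \<union> (rose_edges s t p)\<inverse> \<rparr>"

lemma pair_graph_rose_tree: "pair_graph (rose_tree s t p)"
proof -
  have sub: "parcs (rose_tree s t p) \<subseteq> {1..s + t + 2 + p} \<times> {1..s + t + 2 + p}"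
    by (auto simp: rose_tree_def rose_edges_def Let_def)
  show ?thesis
  proof (unfold_locales, goal_cases)
    case (1 e)
    with sub show ?case by (auto simp: rose_tree_def)
  next
    case (2 e)
    with sub show ?case by (auto simp: rose_tree_def)
  next
    case 3
    show ?case by (simp add: rose_tree_def)
  next
    case 4
    show ?case using finite_subset[OF sub] by simp
  next
    case (5 e)
    then show ?case by (auto simp: rose_tree_def rose_edges_def Let_def)
  next
    case 6
    show ?case by (auto simp: symmetric_def rose_tree_def sym_def)
  qed
qed

end

theory Submission
  imports Defs "HOL-Real_Asymp.Real_Asymp"
begin

text \<open>
  Write an eigenvalue as \<open>2 - 2 cos w\<close>. An eigenvector is then a cosine wave on each of the two arms
  and constant on the petals, so it is described by two amplitudes and the petal value, subject to
  matching conditions at the branch vertex. Let \<open>\<sigma> = \<pi> / (2 s + 1)\<close> and \<open>\<tau> = \<pi> / (2 t + 1)\<close> be the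
  lowest frequencies of the arms with the branch vertex held at zero, and \<open>r\<close> that of the rose.

  For \<open>s = t\<close> the antisymmetric wave of frequency \<open>\<sigma>\<close> is the Fiedler vector, and attains its extrema at
  the two ends, as long as \<open>\<sigma> < r\<close>, that is \<open>p < (1 - \<mu>)\<^sup>2 / \<mu>\<close> with \<open>\<mu> = 2 - 2 cos \<sigma>\<close>. Otherwise a symmetric
  eigenvector of frequency at most \<open>\<sigma>\<close> rules out (FED).

  In general the Fiedler frequency is at most the second smallest of \<open>\<sigma>\<close>, \<open>\<tau>\<close>, \<open>r\<close>, by a sign change of
  the secular function. Once \<open>p\<close> is larger than a multiple of \<open>s\<^sup>2\<close> we have \<open>r < \<sigma>\<close>, and then either the
  petals lie beyond the end of the first arm, or the two ends have equal signs.
\<close>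

section \<open>Laplacians and algebraic connectivity\<close>

lemma order_char_poly_simple_zero:
  fixes A :: "real mat"
  assumes A: "A \<in> carrier_mat n n" and n: "0 < n"
    and colsum: "\<And>j. j < n \<Longrightarrow> (\<Sum>i = 0..<n. A $$ (i, j)) = 0"
    and ker: "\<And>v. v \<in> carrier_vec n \<Longrightarrow> A *\<^sub>v v = 0\<^sub>v n \<Longrightarrow> (\<Sum>i = 0..<n. v $ i) = 0 \<Longrightarrow> v = 0\<^sub>v n"
  shows "order 0 (char_poly A) = 1"
proof -
  \<comment> \<open>Adding all rows of \<open>x I - A\<close> to the first one turns it into \<open>(x, \<dots>, x)\<close>, so a factor \<open>x\<close>
    splits off; the remaining determinant does not vanish at \<open>0\<close>.\<close>
  define K where "K = char_poly_matrix A"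
  define E :: "real poly mat" where "E = mat n n (\<lambda>(i, j). if i = 0 \<or> i = j then 1 else 0)"
  define M where "M = mat n n (\<lambda>(i, j). if i = 0 then 1 else K $$ (i, j))"
  define M0 :: "real mat" where "M0 = mat n n (\<lambda>(i, j). if i = 0 then 1 else - A $$ (i, j))"
  have K: "K \<in> carrier_mat n n" and E: "E \<in> carrier_mat n n" and M: "M \<in> carrier_mat n n"
    and M0: "M0 \<in> carrier_mat n n"
    using A by (auto simp: K_def E_def M_def M0_def)
  have Kij: "K $$ (i, j) = (if i = j then [:0, 1:] else 0) + [: - A $$ (i, j) :]"
    if "i < n" "j < n" for i j
    using that A by (auto simp: K_def char_poly_matrix_def)
  have Ksum: "(\<Sum>i = 0..<n. K $$ (i, j)) = [:0, 1:]" if "j < n" for j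
  proof -
    have "(\<Sum>i = 0..<n. K $$ (i, j))
        = (\<Sum>i = 0..<n. (if i = j then [:0, 1:] else 0)) + (\<Sum>i = 0..<n. [: - A $$ (i, j) :])"
      using that by (simp add: Kij sum.distrib)
    also have "(\<Sum>i = 0..<n. [: - A $$ (i, j) :]) = [: \<Sum>i = 0..<n. - A $$ (i, j) :]"
      by (induction n) simp_all
    also have "\<dots> = 0"
      using colsum[OF that] by (simp add: sum_negf)
    finally show ?thesis using that by simp
  qed
  have EK: "E * K = multrow 0 [:0, 1:] M"
  proof (rule eq_matI)
    fix i j assume "i < dim_row (multrow 0 [:0, 1:] M)" "j < dim_col (multrow 0 [:0, 1:] M)"
    then have ij: "i < n" "j < n" using M by auto
    have "(E * K) $$ (i, j) = (\<Sum>k = 0..<n. (if i = 0 \<or> i = k then 1 else 0) * K $$ (k, j))"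
      using ij E K by (auto simp: scalar_prod_def E_def intro!: sum.cong)
    also have "\<dots> = (if i = 0 then [:0, 1:] else K $$ (i, j))"
    proof (cases "i = 0")
      case False
      then have "(\<Sum>k = 0..<n. (if i = 0 \<or> i = k then 1 else 0) * K $$ (k, j))
          = (\<Sum>k = 0..<n. if i = k then K $$ (k, j) else 0)"
        by (intro sum.cong) auto
      then show ?thesis using False ij by simp
    qed (use Ksum ij in simp)
    finally show "(E * K) $$ (i, j) = multrow 0 [:0, 1:] M $$ (i, j)"
      using ij M by (auto simp: M_def)
  qed (use E K M in auto)
  have "upper_triangular E"
    by (auto simp: upper_triangular_def E_def)
  then have "det E = prod_list (diag_mat E)"
    using E by (rule det_upper_triangular)
  also have "\<dots> = 1"
    by (rule prod_list_neutral) (auto simp: diag_mat_def E_def)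
  finally have detE: "det E = 1" .
  have "char_poly A = det (E * K)"
    using det_mult[OF E K] detE by (simp add: char_poly_def K_def)
  then have cp: "char_poly A = [:0, 1:] * det M"
    using det_multrow[OF n M] EK by simp
  have "poly (det M) 0 = det M0"
    by (rule poly_det_cong[OF M0 M]) (auto simp: M_def M0_def Kij)
  also have "det M0 \<noteq> 0"
  proof
    assume "det M0 = 0"
    then obtain v where v: "v \<in> carrier_vec n" "v \<noteq> 0\<^sub>v n" "M0 *\<^sub>v v = 0\<^sub>v n"
      using det_0_iff_vec_prod_zero_field[OF M0] by blast
    have row: "(\<Sum>j = 0..<n. M0 $$ (i, j) * v $ j) = 0" if "i < n" for i
      using arg_cong[OF v(3), of "\<lambda>w. w $ i"] that v(1) M0 by (simp add: scalar_prod_def)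
    have s0: "(\<Sum>j = 0..<n. v $ j) = 0"
      using row[OF n] n by (simp add: M0_def)
    have rowA: "(\<Sum>j = 0..<n. A $$ (i, j) * v $ j) = 0" if "0 < i" "i < n" for i
      using row[OF that(2)] that by (simp add: M0_def sum_negf)
    \<comment> \<open>Row \<open>0\<close> of \<open>A\<close> was overwritten by ones in
      \<open>M0\<close>. Its equation is recovered from the zero column sums: the entries of
      \<open>A *\<^sub>v v\<close> add up to zero and all but the first are known to vanish.\<close>
    have "(\<Sum>i = 0..<n. \<Sum>j = 0..<n. A $$ (i, j) * v $ j) = 0"
      by (subst sum.swap) (simp add: sum_distrib_right[symmetric] colsum)
    moreover have "(\<Sum>i = 0..<n. \<Sum>j = 0..<n. A $$ (i, j) * v $ j) = (\<Sum>j = 0..<n. A $$ (0, j) * v $ j)"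
      using n rowA by (subst sum.atLeast_Suc_lessThan) (auto intro!: sum.neutral)
    ultimately have "(\<Sum>j = 0..<n. A $$ (i, j) * v $ j) = 0" if "i < n" for i
      using rowA that by (cases "i = 0") auto
    then have "A *\<^sub>v v = 0\<^sub>v n"
      using A v(1) by (intro eq_vecI) (auto simp: scalar_prod_def)
    with ker v s0 show False by blast
  qed
  finally have *: "poly (det M) 0 \<noteq> 0" .
  then have nz: "det M \<noteq> 0" by auto
  have "order 0 (char_poly A) = order 0 [:0, 1::real:] + order 0 (det M)"
    unfolding cp using nz by (intro order_mult) (simp add: cp del: mult_pCons_left)
  also have "order 0 [:0, 1::real:] = 1"
    using order_power_n_n[of "0::real" 1] by simp
  also have "order 0 (det M) = 0"
    using * by (simp add: order_0I)
  finally show ?thesis by simp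
qed

text \<open>The least element occurs once, so removing it shifts the sorted list by exactly one
  place and index \<open>1\<close> becomes the minimum of what remains.\<close>

lemma second_of_sorted_multiset:
  fixes X :: "'a :: linorder multiset"
  assumes "count X z = 1" and "\<And>x. x \<in># X \<Longrightarrow> z \<le> x" and "\<exists>x \<in># X. z < x"
  defines "y \<equiv> sorted_list_of_multiset X ! 1"
  shows "y \<in># X" and "z < y" and "\<And>x. x \<in># X \<Longrightarrow> z < x \<Longrightarrow> y \<le> x"
proof -
  define Y where "Y = X - {#z#}"
  have zX: "z \<in># X" using assms(1) by (simp add: count_greater_zero_iff[symmetric])
  then have X: "X = add_mset z Y" by (simp add: Y_def)
  have z: "z \<notin># Y" using assms(1) by (simp add: Y_def not_in_iff)
  have "z \<le> x" if "x \<in># Y" for x using assms(2) X that by auto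
  then have "sorted_list_of_multiset X = z # sorted_list_of_multiset Y"
    unfolding X by (cases "sorted_list_of_multiset Y")
      (auto simp: insort_is_Cons  simp flip: set_sorted_list_of_multiset)
  then have y: "y = sorted_list_of_multiset Y ! 0" by (simp add: y_def)
  have "Y \<noteq> {#}" using assms(3) X by auto
  then obtain a ys where ys: "sorted_list_of_multiset Y = a # ys"
    by (metis list.exhaust mset_sorted_list_of_multiset mset_zero_iff)
  have yY: "y \<in># Y" using y ys by (metis list.set_intros(1) nth_Cons_0 set_sorted_list_of_multiset)
  then show "y \<in># X" using X by simp
  show "z < y" using yY z assms(2) X by (metis order_le_less union_iff add_mset_add_single)
  fix x assume "x \<in># X" "z < x"
  then have "x \<in> set (sorted_list_of_multiset Y)" using X by auto
  moreover have "sorted (sorted_list_of_multiset Y)" by simp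
  ultimately show "y \<le> x" using y ys by auto
qed

context
  fixes G :: "'a::linorder pair_pre_digraph"
  assumes G: "pair_graph G"
begin

lemma vertex_list: "distinct (vertex_list G)" "set (vertex_list G) = pverts G"
  "length (vertex_list G) = card (pverts G)"
proof -
  interpret pair_graph G by (rule G)
  show "distinct (vertex_list G)" "set (vertex_list G) = pverts G"
    "length (vertex_list G) = card (pverts G)"
    by (auto simp: vertex_list_def)
qed

lemma laplacian_carrier: "laplacian G \<in> carrier_mat (card (pverts G)) (card (pverts G))"
  by (auto simp: laplacian_def degree_matrix_def adjacency_matrix_def)

lemma out_degree_eq_neighbours:
  "out_degree (with_proj G) (vertex_list G ! i)
    = card {j. j < card (pverts G) \<and> (vertex_list G ! i, vertex_list G ! j) \<in> parcs G}"
proof -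
  interpret pair_graph G by (rule G)
  let ?u = "vertex_list G ! i"
  have "out_arcs (with_proj G) ?u
      = (\<lambda>j. (?u, vertex_list G ! j)) ` {j. j < card (pverts G) \<and> (?u, vertex_list G ! j) \<in> parcs G}"
  proof (intro equalityI subsetI)
    fix e assume "e \<in> out_arcs (with_proj G) ?u"
    then have e: "e \<in> parcs G" "fst e = ?u" by auto
    then have "snd e \<in> set (vertex_list G)"
      using in_arcsD2 vertex_list(2) by (metis prod.collapse)
    then obtain j where "j < card (pverts G)" "vertex_list G ! j = snd e"
      using vertex_list(3) by (metis in_set_conv_nth)
    moreover have "(?u, snd e) \<in> parcs G"
      using e by (metis prod.collapse)
    ultimately show "e \<in> (\<lambda>j. (?u, vertex_list G ! j)) ` {j. j < card (pverts G) \<and> (?u, vertex_list G ! j) \<in> parcs G}"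
      using e by (intro image_eqI[of _ _ j]) (auto simp: prod_eq_iff)
  qed auto
  moreover have "inj_on (\<lambda>j. (?u, vertex_list G ! j)) {j. j < card (pverts G) \<and> (?u, vertex_list G ! j) \<in> parcs G}"
    using vertex_list by (auto simp: inj_on_def nth_eq_iff_index_eq)
  ultimately show ?thesis
    by (simp add: out_degree_def card_image)
qed

lemma laplacian_mult_vec:
  assumes "v \<in> carrier_vec (card (pverts G))" "i < card (pverts G)"
  shows "(laplacian G *\<^sub>v v) $ i
    = (\<Sum>j | j < card (pverts G) \<and> (vertex_list G ! i, vertex_list G ! j) \<in> parcs G. v $ i - v $ j)"
proof -
  let ?n = "card (pverts G)"
  let ?R = "\<lambda>j. (vertex_list G ! i, vertex_list G ! j) \<in> parcs G"
  have "(laplacian G *\<^sub>v v) $ i = (\<Sum>j = 0..<?n. laplacian G $$ (i, j) * v $ j)"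
    using assms laplacian_carrier by (auto simp: scalar_prod_def)
  also have "\<dots> = (\<Sum>j = 0..<?n. (if j = i then real (card {j. j < ?n \<and> ?R j}) * v $ j else 0)
      - (if ?R j then v $ j else 0))"
    using assms by (intro sum.cong)
      (auto simp: laplacian_def degree_matrix_def adjacency_matrix_def out_degree_eq_neighbours
         algebra_simps)
  also have "\<dots> = real (card {j. j < ?n \<and> ?R j}) * v $ i - (\<Sum>j = 0..<?n. if ?R j then v $ j else 0)"
    using assms by (simp add: sum_subtractf)
  also have "(\<Sum>j = 0..<?n. if ?R j then v $ j else 0) = (\<Sum>j | j < ?n \<and> ?R j. v $ j)"
    by (simp add: sum.inter_filter[symmetric])
  also have "real (card {j. j < ?n \<and> ?R j}) * v $ i = (\<Sum>j | j < ?n \<and> ?R j. v $ i)"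
    by simp
  finally show ?thesis by (simp add: sum_subtractf)
qed

lemma laplacian_column_sum:
  assumes "j < card (pverts G)"
  shows "(\<Sum>i = 0..<card (pverts G). laplacian G $$ (i, j)) = 0"
proof -
  interpret pair_graph G by (rule G)
  let ?n = "card (pverts G)"
  let ?R = "\<lambda>i j. (vertex_list G ! i, vertex_list G ! j) \<in> parcs G"
  have sym: "?R i j \<longleftrightarrow> ?R j i" for i j
    by (meson arcs_symmetric)
  have "(\<Sum>i = 0..<?n. laplacian G $$ (i, j))
     = (\<Sum>i = 0..<?n. (if i = j then real (card {i. i < ?n \<and> ?R j i}) else 0) - (if ?R j i then 1 else 0))"
    using assms by (intro sum.cong)
      (auto simp: laplacian_def degree_matrix_def adjacency_matrix_def out_degree_eq_neighbours sym)
  also have "\<dots> = 0"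
    using assms by (simp add: sum_subtractf sum.inter_filter[symmetric])
  finally show ?thesis .
qed

text \<open>A maximum principle: at an index where \<open>\<bar>v $ i\<bar>\<close> is largest,
  every term of the row equation multiplied by \<open>v $ i\<close> is nonnegative.\<close>

lemma laplacian_eigenvalue_nonneg:
  assumes "eigenvalue (laplacian G) a"
  shows "0 \<le> a"
proof -
  let ?n = "card (pverts G)"
  let ?R = "\<lambda>i j. (vertex_list G ! i, vertex_list G ! j) \<in> parcs G"
  obtain v where v: "v \<in> carrier_vec ?n" "v \<noteq> 0\<^sub>v ?n" "laplacian G *\<^sub>v v = a \<cdot>\<^sub>v v"
    using assms laplacian_carrier by (auto simp: eigenvalue_def eigenvector_def)
  from v(1,2) obtain k where k: "k < ?n" "v $ k \<noteq> 0" by (metis carrier_vecD eq_vecI index_zero_vec)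
  have "Max ((\<lambda>i. \<bar>v $ i\<bar>) ` {..<?n}) \<in> (\<lambda>i. \<bar>v $ i\<bar>) ` {..<?n}"
    using k(1) by (intro Max_in) auto
  then obtain i where i: "i < ?n" "\<bar>v $ i\<bar> = Max ((\<lambda>i. \<bar>v $ i\<bar>) ` {..<?n})"
    by auto
  have i': "\<bar>v $ j\<bar> \<le> \<bar>v $ i\<bar>" if "j < ?n" for j
    unfolding i(2) using that by (intro Max_ge) auto
  have vi: "v $ i \<noteq> 0" using i'[OF k(1)] k(2) by auto
  have "a * v $ i = (\<Sum>j | j < ?n \<and> ?R i j. v $ i - v $ j)"
    using laplacian_mult_vec[OF v(1) i(1)] v i by simp
  then have "a * v $ i * v $ i = (\<Sum>j | j < ?n \<and> ?R i j. (v $ i - v $ j) * v $ i)"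
    by (simp add: sum_distrib_right)
  also have "\<dots> \<ge> 0"
  proof (rule sum_nonneg)
    fix j assume "j \<in> {j. j < ?n \<and> ?R i j}"
    then have "\<bar>v $ j * v $ i\<bar> \<le> v $ i * v $ i"
      using i'[of j] by (auto simp: abs_mult intro: order_trans[OF mult_right_mono])
    then show "0 \<le> (v $ i - v $ j) * v $ i" by (simp add: left_diff_distrib)
  qed
  finally show "0 \<le> a" using vi by (simp add: mult.assoc zero_le_mult_iff) (smt (verit) zero_less_mult_iff vi)
qed

text \<open>Bridges the definition by sorted roots and the description by eigenvalues. Constant
  vectors with zero sum vanish, which makes \<open>0\<close> a simple root by
  \<open>order_char_poly_simple_zero\<close>; all other real roots are positive.\<close>

lemma algebraic_connectivity_least_positive:
  assumes ker: "\<And>v. v \<in> carrier_vec (card (pverts G)) \<Longrightarrow> laplacian G *\<^sub>v v = 0\<^sub>v (card (pverts G)) \<Longrightarrow>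
      \<exists>c. \<forall>i < card (pverts G). v $ i = c"
    and pos: "eigenvalue (laplacian G) a" "0 < a"
  shows "eigenvalue (laplacian G) (algebraic_connectivity G)"
    and "0 < algebraic_connectivity G"
    and "\<And>b. eigenvalue (laplacian G) b \<Longrightarrow> 0 < b \<Longrightarrow> algebraic_connectivity G \<le> b"
proof -
  let ?n = "card (pverts G)" and ?p = "char_poly (laplacian G)"
  have n: "0 < ?n" using pos laplacian_carrier eigenvalue_imp_nonzero_dim by blast
  have "order 0 ?p = 1"
  proof (rule order_char_poly_simple_zero[OF laplacian_carrier n laplacian_column_sum])
    fix v assume v: "v \<in> carrier_vec ?n" "laplacian G *\<^sub>v v = 0\<^sub>v ?n" "(\<Sum>i = 0..<?n. v $ i) = 0"
    then obtain c where c: "\<forall>i < ?n. v $ i = c" using ker by blast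
    with v(3) n have "c = 0" by simp
    with c v(1) show "v = 0\<^sub>v ?n" by (intro eq_vecI) auto
  qed
  moreover have p0: "?p \<noteq> 0"
    using degree_monic_char_poly[OF laplacian_carrier] by auto
  moreover note root = eigenvalue_root_char_poly[OF laplacian_carrier]
  ultimately have "count (proots ?p) 0 = 1" "\<And>x. x \<in># proots ?p \<Longrightarrow> 0 \<le> x" "\<exists>x\<in>#proots ?p. 0 < x"
    using laplacian_eigenvalue_nonneg pos by auto
  note * = second_of_sorted_multiset[OF this, folded algebraic_connectivity_def]
  from * show "eigenvalue (laplacian G) (algebraic_connectivity G)" "0 < algebraic_connectivity G"
    using p0 root by auto
  show "algebraic_connectivity G \<le> b" if "eigenvalue (laplacian G) b" "0 < b" for b
    using *(3)[of b] that p0 root by auto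
qed

end

section \<open>Eigenvectors of the Rose tree\<close>

lemma card_rose_tree: "card (pverts (rose_tree s t p)) = s + t + 2 + p"
  by (simp add: rose_tree_def)

lemma vertex_list_rose_tree: "i < s + t + 2 + p \<Longrightarrow> vertex_list (rose_tree s t p) ! i = Suc i"
proof -
  have "vertex_list (rose_tree s t p) = [1..<Suc (s + t + 2 + p)]"
    unfolding vertex_list_def rose_tree_def pair_pre_digraph.select_convs
    by (metis atLeastLessThanSuc_atLeastAtMost sorted_list_of_set_range)
  then show "i < s + t + 2 + p \<Longrightarrow> ?thesis" by (simp del: upt_Suc)
qed

lemma rose_arc_iff: "(u, w) \<in> parcs (rose_tree s t p) \<longleftrightarrow>
      w = u + 1 \<and> 1 \<le> u \<and> u \<le> s + t \<or> u = w + 1 \<and> 1 \<le> w \<and> w \<le> s + t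
      \<or> u = s + 1 \<and> w = s + t + 2 \<or> w = s + 1 \<and> u = s + t + 2
      \<or> u = s + t + 2 \<and> s + t + 2 < w \<and> w \<le> s + t + 2 + p
      \<or> w = s + t + 2 \<and> s + t + 2 < u \<and> u \<le> s + t + 2 + p"
proof -
  have "(\<exists>j. w = s + t + 2 + j \<and> 1 \<le> j \<and> j \<le> p) \<longleftrightarrow> s + t + 2 < w \<and> w \<le> s + t + 2 + p" for w
    by presburger
  then show ?thesis
    by (simp add: rose_tree_def rose_edges_def Let_def) blast
qed

text \<open>The Laplacian equations vertex by vertex, in the numbering of the tree, so that waves
  can be inserted without index shifts. The clauses treat, in order, the end \<open>1\<close>, the
  inner arm vertices, the branch vertex, the other end, the centre and the petals.\<close>

definition rose_eigen :: "nat \<Rightarrow> nat \<Rightarrow> nat \<Rightarrow> real \<Rightarrow> (nat \<Rightarrow> real) \<Rightarrow> bool" where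
  "rose_eigen s t p a g \<longleftrightarrow>
     g 1 - g 2 = a * g 1 \<and>
     (\<forall>i. 2 \<le> i \<and> i \<le> s + t \<and> i \<noteq> s + 1 \<longrightarrow> 2 * g i - g (i - 1) - g (i + 1) = a * g i) \<and>
     3 * g (s + 1) - g s - g (s + 2) - g (s + t + 2) = a * g (s + 1) \<and>
     g (s + t + 1) - g (s + t) = a * g (s + t + 1) \<and>
     real (p + 1) * g (s + t + 2) - g (s + 1) - (\<Sum>w = s + t + 3..s + t + 2 + p. g w) = a * g (s + t + 2) \<and>
     (\<forall>j. 1 \<le> j \<and> j \<le> p \<longrightarrow> g (s + t + 2 + j) - g (s + t + 2) = a * g (s + t + 2 + j))"

context
  fixes s t p :: nat
  assumes s: "1 \<le> s" and t: "1 \<le> t"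
begin

lemma rose_tree_neighbours:
  shows "{w. (1, w) \<in> parcs (rose_tree s t p)} = {2}"
    and "2 \<le> i \<Longrightarrow> i \<le> s + t \<Longrightarrow> i \<noteq> s + 1 \<Longrightarrow> {w. (i, w) \<in> parcs (rose_tree s t p)} = {i - 1, i + 1}"
    and "{w. (s + 1, w) \<in> parcs (rose_tree s t p)} = {s, s + 2, s + t + 2}"
    and "{w. (s + t + 1, w) \<in> parcs (rose_tree s t p)} = {s + t}"
    and "{w. (s + t + 2, w) \<in> parcs (rose_tree s t p)} = insert (s + 1) {s + t + 3..s + t + 2 + p}"
    and "1 \<le> j \<Longrightarrow> j \<le> p \<Longrightarrow> {w. (s + t + 2 + j, w) \<in> parcs (rose_tree s t p)} = {s + t + 2}"
proof -
  show "{w. (1, w) \<in> parcs (rose_tree s t p)} = {2}"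
    unfolding rose_arc_iff using s t by auto
  show "{w. (i, w) \<in> parcs (rose_tree s t p)} = {i - 1, i + 1}"
    if "2 \<le> i" "i \<le> s + t" "i \<noteq> s + 1"
    unfolding rose_arc_iff using s t that by auto
  show "{w. (s + 1, w) \<in> parcs (rose_tree s t p)} = {s, s + 2, s + t + 2}"
    unfolding rose_arc_iff using s t by auto
  show "{w. (s + t + 1, w) \<in> parcs (rose_tree s t p)} = {s + t}"
    unfolding rose_arc_iff using s t by auto
  show "{w. (s + t + 2, w) \<in> parcs (rose_tree s t p)} = insert (s + 1) {s + t + 3..s + t + 2 + p}"
    unfolding rose_arc_iff using s t by auto
  show "{w. (s + t + 2 + j, w) \<in> parcs (rose_tree s t p)} = {s + t + 2}" if "1 \<le> j" "j \<le> p"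
    unfolding rose_arc_iff using s t that by auto
qed

lemma rose_laplacian_mult:
  assumes v: "v \<in> carrier_vec (s + t + 2 + p)" and u: "1 \<le> u" "u \<le> s + t + 2 + p"
  shows "(laplacian (rose_tree s t p) *\<^sub>v v) $ (u - 1)
    = (\<Sum>w | (u, w) \<in> parcs (rose_tree s t p). v $ (u - 1) - v $ (w - 1))"
proof -
  let ?G = "rose_tree s t p" and ?n = "s + t + 2 + p"
  interpret pair_graph ?G by (rule pair_graph_rose_tree)
  have "(laplacian ?G *\<^sub>v v) $ (u - 1)
     = (\<Sum>j | j < ?n \<and> (u, vertex_list ?G ! j) \<in> parcs ?G. v $ (u - 1) - v $ j)"
    using laplacian_mult_vec[OF pair_graph_rose_tree, of v s t p "u - 1"] v u
    by (simp add: card_rose_tree vertex_list_rose_tree)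
  also have "\<dots> = (\<Sum>w | (u, w) \<in> parcs ?G. v $ (u - 1) - v $ (w - 1))"
  proof (rule sum.reindex_bij_witness[of _ "\<lambda>w. w - 1" Suc], goal_cases)
    case (4 w)
    then have "w \<in> pverts ?G" using in_arcsD2 by simp
    then have "1 \<le> w" "w \<le> ?n" by (auto simp: rose_tree_def)
    with 4 show ?case by (auto simp: vertex_list_rose_tree)
  next
    case (3 w)
    then have "w \<in> pverts ?G" using in_arcsD2 by simp
    then show ?case by (auto simp: rose_tree_def)
  qed (auto simp: vertex_list_rose_tree)
  finally show ?thesis .
qed

lemma rose_laplacian_eigen_iff:
  assumes v: "v \<in> carrier_vec (s + t + 2 + p)"
  shows "laplacian (rose_tree s t p) *\<^sub>v v = a \<cdot>\<^sub>v v \<longleftrightarrow> rose_eigen s t p a (\<lambda>u. v $ (u - 1))"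
proof -
  let ?G = "rose_tree s t p" and ?n = "s + t + 2 + p"
  define g where "g = (\<lambda>u. v $ (u - 1))"
  define F where "F u \<longleftrightarrow> (\<Sum>w | (u, w) \<in> parcs ?G. g u - g w) = a * g u" for u
  have L: "laplacian ?G \<in> carrier_mat ?n ?n"
    using laplacian_carrier[OF pair_graph_rose_tree, of s t p] by (simp add: card_rose_tree)
  have "laplacian ?G *\<^sub>v v = a \<cdot>\<^sub>v v \<longleftrightarrow> (\<forall>i < ?n. (laplacian ?G *\<^sub>v v) $ i = a * v $ i)"
  proof
    assume "laplacian ?G *\<^sub>v v = a \<cdot>\<^sub>v v"
    then show "\<forall>i < ?n. (laplacian ?G *\<^sub>v v) $ i = a * v $ i"
      using v by (simp del: index_mult_mat_vec)
  next
    assume "\<forall>i < ?n. (laplacian ?G *\<^sub>v v) $ i = a * v $ i"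
    then show "laplacian ?G *\<^sub>v v = a \<cdot>\<^sub>v v"
      using L v by (intro eq_vecI) (simp_all del: index_mult_mat_vec)
  qed
  also have "\<dots> \<longleftrightarrow> (\<forall>u \<in> {1..?n}. (laplacian ?G *\<^sub>v v) $ (u - 1) = a * g u)"
  proof (intro iffI allI impI ballI)
    fix i assume "\<forall>u \<in> {1..?n}. (laplacian ?G *\<^sub>v v) $ (u - 1) = a * g u" "i < ?n"
    then show "(laplacian ?G *\<^sub>v v) $ i = a * v $ i"
      by (metis (no_types, lifting) Suc_leI atLeastAtMost_iff diff_Suc_1 g_def le_add1 plus_1_eq_Suc)
  qed (auto simp: g_def simp del: index_mult_mat_vec)
  also have "\<dots> \<longleftrightarrow> (\<forall>u \<in> {1..?n}. F u)"
    using rose_laplacian_mult[OF v] by (simp add: F_def g_def del: index_mult_mat_vec)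
  also have "{1..?n} = {1} \<union> {i. 2 \<le> i \<and> i \<le> s + t \<and> i \<noteq> s + 1} \<union> {s + 1, s + t + 1, s + t + 2}
      \<union> (\<lambda>j. s + t + 2 + j) ` {j. 1 \<le> j \<and> j \<le> p}"
  proof (intro equalityI subsetI)
    fix u assume u: "u \<in> {1..?n}"
    show "u \<in> {1} \<union> {i. 2 \<le> i \<and> i \<le> s + t \<and> i \<noteq> s + 1} \<union> {s + 1, s + t + 1, s + t + 2}
      \<union> (\<lambda>j. s + t + 2 + j) ` {j. 1 \<le> j \<and> j \<le> p}"
    proof (cases "u \<le> s + t + 2")
      case False
      then have "u = s + t + 2 + (u - (s + t + 2))" "u - (s + t + 2) \<in> {j. 1 \<le> j \<and> j \<le> p}"
        using u by auto
      then show ?thesis by blast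
    qed (use u in auto)
  qed (use s t in auto)
  also have "(\<forall>u \<in> {1} \<union> {i. 2 \<le> i \<and> i \<le> s + t \<and> i \<noteq> s + 1} \<union> {s + 1, s + t + 1, s + t + 2}
      \<union> (\<lambda>j. s + t + 2 + j) ` {j. 1 \<le> j \<and> j \<le> p}. F u) \<longleftrightarrow>
      F 1 \<and> (\<forall>i. 2 \<le> i \<and> i \<le> s + t \<and> i \<noteq> s + 1 \<longrightarrow> F i) \<and> F (s + 1) \<and> F (s + t + 1) \<and> F (s + t + 2)
      \<and> (\<forall>j. 1 \<le> j \<and> j \<le> p \<longrightarrow> F (s + t + 2 + j))"
    by (simp add: ball_Un) blast
  also have "F 1 \<longleftrightarrow> g 1 - g 2 = a * g 1"
    unfolding F_def rose_tree_neighbours by simp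
  also have "(\<forall>i. 2 \<le> i \<and> i \<le> s + t \<and> i \<noteq> s + 1 \<longrightarrow> F i)
     \<longleftrightarrow> (\<forall>i. 2 \<le> i \<and> i \<le> s + t \<and> i \<noteq> s + 1 \<longrightarrow> 2 * g i - g (i - 1) - g (i + 1) = a * g i)"
    by (auto simp: F_def rose_tree_neighbours algebra_simps)
  also have "F (s + 1) \<longleftrightarrow> 3 * g (s + 1) - g s - g (s + 2) - g (s + t + 2) = a * g (s + 1)"
    using t unfolding F_def rose_tree_neighbours by (simp add: algebra_simps)
  also have "F (s + t + 1) \<longleftrightarrow> g (s + t + 1) - g (s + t) = a * g (s + t + 1)"
    unfolding F_def rose_tree_neighbours by simp
  also have "F (s + t + 2) \<longleftrightarrow>
      real (p + 1) * g (s + t + 2) - g (s + 1) - (\<Sum>w = s + t + 3..s + t + 2 + p. g w) = a * g (s + t + 2)"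
    unfolding F_def rose_tree_neighbours by (simp add: sum_subtractf algebra_simps)
  also have "(\<forall>j. 1 \<le> j \<and> j \<le> p \<longrightarrow> F (s + t + 2 + j)) \<longleftrightarrow>
     (\<forall>j. 1 \<le> j \<and> j \<le> p \<longrightarrow> g (s + t + 2 + j) - g (s + t + 2) = a * g (s + t + 2 + j))"
    unfolding F_def using rose_tree_neighbours(6) by (simp del: add_2_eq_Suc')
  finally show ?thesis
    unfolding rose_eigen_def g_def by simp
qed

end

section \<open>Cosine waves on an arm\<close>

definition wave :: "real \<Rightarrow> nat \<Rightarrow> real" where
  "wave w k = cos ((real k - 1 / 2) * w)"

definition freq_eigenvalue :: "real \<Rightarrow> real" where
  "freq_eigenvalue w = 2 - 2 * cos w"

lemma wave_rec:
  assumes "1 \<le> k"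
  shows "2 * wave w k - wave w (k - 1) - wave w (k + 1) = freq_eigenvalue w * wave w k"
proof -
  define z where "z = (real k - 1 / 2) * w"
  have "wave w (k - 1) = cos (z - w)" "wave w (k + 1) = cos (z + w)" "wave w k = cos z"
    using assms by (auto simp: wave_def z_def of_nat_diff algebra_simps)
  then show ?thesis
    by (simp add: freq_eigenvalue_def cos_add cos_diff algebra_simps)
qed

text \<open>The half-integer phase makes the wave even about the point midway between
  \<open>0\<close> and \<open>1\<close>. A fictitious vertex \<open>0\<close> beyond the free end
  repeats the end value, and the leaf equation becomes an instance of the inner recurrence.\<close>

lemma wave_0: "wave w 0 = wave w 1"
  by (simp add: wave_def)

lemma wave_start: "wave w 1 - wave w 2 = freq_eigenvalue w * wave w 1"
  using wave_rec[of 1 w] wave_0[of w] by (simp add: numeral_2_eq_2)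

text \<open>The leaf equation and the recurrence determine everything from \<open>f 1\<close>, and
  the wave solves both. The amplitude divides by \<open>wave w 1 = cos (w / 2)\<close>, which is
  nonzero because \<open>w < pi\<close>.\<close>

lemma path_recurrence_solution:
  fixes f :: "nat \<Rightarrow> real"
  assumes start: "f 1 - f 2 = freq_eigenvalue w * f 1"
    and rec: "\<And>i. 2 \<le> i \<Longrightarrow> i \<le> m \<Longrightarrow> 2 * f i - f (i - 1) - f (i + 1) = freq_eigenvalue w * f i"
    and w: "0 \<le> w" "w < pi"
    and i: "1 \<le> i" "i \<le> m + 1" "1 \<le> m"
  shows "f i = f 1 / cos (w / 2) * wave w i"
  using i
proof (induction i rule: less_induct)
  case (less i)
  have c: "cos (w / 2) \<noteq> 0" using w cos_gt_zero_pi[of "w / 2"] by auto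
  have w1: "wave w 1 = cos (w / 2)" by (simp add: wave_def)
  define A where "A = f 1 / cos (w / 2)"
  consider "i = 1" | "i = 2" | k where "i = k + 1" "2 \<le> k"
  proof (cases "i \<le> 2")
    case False
    then have "i = (i - 1) + 1" "2 \<le> i - 1" by auto
    then show ?thesis using that(3) by blast
  qed (use less.prems(1) that in fastforce)
  then show ?case
  proof cases
    case 1
    then show ?thesis using c w1 by simp
  next
    case 2
    have "wave w 2 = (1 - freq_eigenvalue w) * wave w 1"
      using wave_start[of w] by (simp add: algebra_simps)
    moreover have "f 2 = (1 - freq_eigenvalue w) * f 1" using start by (simp add: algebra_simps)
    ultimately show ?thesis using 2 c w1 by simp
  next
    case (3 k)
    have "f k = A * wave w k" "f (k - 1) = A * wave w (k - 1)"
      unfolding A_def using less.IH[of k] less.IH[of "k - 1"] 3 less.prems by auto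
    moreover have "f (k + 1) = 2 * f k - f (k - 1) - freq_eigenvalue w * f k"
      using rec[of k] 3 less.prems by auto
    ultimately have "f (k + 1) = A * (2 * wave w k - wave w (k - 1) - freq_eigenvalue w * wave w k)"
      by (simp add: algebra_simps)
    also have "2 * wave w k - wave w (k - 1) - freq_eigenvalue w * wave w k = wave w (k + 1)"
      using wave_rec[of k w] 3 by simp
    finally have "f (k + 1) = A * wave w (k + 1)" .
    then show ?thesis unfolding A_def using 3(1) by simp
  qed
qed

section \<open>Matching the arms and the petals at the branch vertex\<close>

definition flux :: "real \<Rightarrow> nat \<Rightarrow> real" where
  "flux w s = wave w s - wave w (s + 1)"

text \<open>If every petal has the value \<open>x\<close>, the equations at the petals and at the centre force the value
  \<open>petal_den p a * x\<close> at the branch vertex, and the centre exceeds the branch vertex by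
  \<open>petal_flux p a * x\<close>.\<close>

definition petal_den :: "nat \<Rightarrow> real \<Rightarrow> real" where
  "petal_den p a = (1 - a)\<^sup>2 - real p * a"

definition petal_flux :: "nat \<Rightarrow> real \<Rightarrow> real" where
  "petal_flux p a = a * (1 - a + real p)"

text \<open>Each arm is counted from its free end, hence the reversed index
  \<open>s + t + 2 - k\<close>. The branch vertex is assigned to the first arm; the second arm
  agrees there under \<open>rose_match\<close>.\<close>

definition rose_mode :: "nat \<Rightarrow> nat \<Rightarrow> real \<Rightarrow> real \<Rightarrow> real \<Rightarrow> real \<Rightarrow> nat \<Rightarrow> real" where
  "rose_mode s t w A B x k =
     (if k \<le> s + 1 then A * wave w k
      else if k \<le> s + t + 1 then B * wave w (s + t + 2 - k)
      else if k = s + t + 2 then (1 - freq_eigenvalue w) * x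
      else x)"

text \<open>The first two equations give both arms the branch value dictated by the petals. The
  third is the eigenvalue equation at the branch vertex, written with the differences neighbour
  minus branch; \<open>flux\<close> is this difference for an arm of amplitude one.\<close>

definition rose_match :: "nat \<Rightarrow> nat \<Rightarrow> nat \<Rightarrow> real \<Rightarrow> real \<Rightarrow> real \<Rightarrow> real \<Rightarrow> bool" where
  "rose_match s t p w A B x \<longleftrightarrow>
     (let a = freq_eigenvalue w; d = petal_den p a * x in
      A * wave w (s + 1) = d \<and> B * wave w (t + 1) = d \<and>
      A * flux w s + B * flux w t + petal_flux p a * x + a * d = 0)"

lemma rose_mode_eigen:
  assumes s: "1 \<le> s" and t: "1 \<le> t"
    and match: "rose_match s t p w A B x"
  shows "rose_eigen s t p (freq_eigenvalue w) (rose_mode s t w A B x)"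
proof -
  let ?g = "rose_mode s t w A B x" and ?a = "freq_eigenvalue w"
  define d where "d = petal_den p ?a * x"
  have m: "A * wave w (s + 1) = d" "B * wave w (t + 1) = d"
    "A * flux w s + B * flux w t + petal_flux p ?a * x + ?a * d = 0"
    using match by (simp_all add: rose_match_def d_def Let_def)
  have d: "d = (1 - ?a)\<^sup>2 * x - real p * ?a * x" by (simp add: d_def petal_den_def algebra_simps)
  have left: "?g k = A * wave w k" if "k \<le> s + 1" for k
    using that by (simp add: rose_mode_def)
  \<comment> \<open>By matching, this formula also covers the branch vertex, as the equation at the
    next vertex of the second arm requires.\<close>
  have right: "?g k = B * wave w (s + t + 2 - k)" if "s + 1 \<le> k" "k \<le> s + t + 1" for k
  proof (cases "k = s + 1")
    case True
    then show ?thesis using m by (simp add: rose_mode_def)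
  qed (use that in \<open>simp add: rose_mode_def\<close>)
  have center: "?g (s + t + 2) = (1 - ?a) * x" by (simp add: rose_mode_def)
  have petal: "?g k = x" if "s + t + 2 < k" for k using that by (simp add: rose_mode_def)
  have bd: "wave w 1 - wave w 2 = ?a * wave w 1"
    by (rule wave_start)
  show ?thesis unfolding rose_eigen_def
  proof (intro conjI allI impI)
    have g12: "?g 1 = A * wave w 1" "?g 2 = A * wave w 2" using s by (simp_all add: left)
    have "?g 1 - ?g 2 = A * (wave w 1 - wave w 2)" unfolding g12 by (rule right_diff_distrib[symmetric])
    also have "\<dots> = ?a * ?g 1" unfolding bd g12 by (rule mult.left_commute)
    finally show "?g 1 - ?g 2 = ?a * ?g 1" .
  next
    fix i assume i: "2 \<le> i \<and> i \<le> s + t \<and> i \<noteq> s + 1"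
    show "2 * ?g i - ?g (i - 1) - ?g (i + 1) = ?a * ?g i"
    proof (cases "i \<le> s")
      case True
      then have "2 * ?g i - ?g (i - 1) - ?g (i + 1)
         = A * (2 * wave w i - wave w (i - 1) - wave w (i + 1))"
        by (simp add: left algebra_simps)
      also have "\<dots> = ?a * ?g i"
        using wave_rec[of i w] i True by (simp add: left)
      finally show ?thesis .
    next
      case False
      \<comment> \<open>Reversal exchanges the two neighbours: \<open>i - 1\<close> lies at position
        \<open>j + 1\<close> and \<open>i + 1\<close> at \<open>j - 1\<close>.\<close>
      define j where "j = s + t + 2 - i"
      have j: "s + t + 2 - (i - 1) = j + 1" "s + t + 2 - (i + 1) = j - 1" "1 \<le> j"
        using i False by (auto simp: j_def)
      have r: "?g i = B * wave w j" "?g (i - 1) = B * wave w (j + 1)" "?g (i + 1) = B * wave w (j - 1)"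
      proof -
        have range: "s + 1 \<le> i - 1" "i - 1 \<le> s + t + 1" "s + 1 \<le> i" "i \<le> s + t + 1" "s + 1 \<le> i + 1"
          "i + 1 \<le> s + t + 1"
          using i False by auto
        show "?g i = B * wave w j" "?g (i - 1) = B * wave w (j + 1)" "?g (i + 1) = B * wave w (j - 1)"
          using right[OF range(1,2)] right[OF range(3,4)] right[OF range(5,6)]
          unfolding j_def[symmetric] j by simp_all
      qed
      have "2 * ?g i - ?g (i - 1) - ?g (i + 1) = B * (2 * wave w j - wave w (j - 1) - wave w (j + 1))"
        unfolding r by (simp only: algebra_simps)
      also have "\<dots> = ?a * ?g i"
        using wave_rec[of j w] j r(1) by simp
      finally show ?thesis .
    qed
  next
    have "?g (s + 2) = B * wave w t"
      using right[of "s + 2"] t by simp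
    moreover have "?g s = A * wave w s" by (simp add: left)
    moreover have "?g (s + 1) = d" using m by (simp add: left)
    moreover have "d - (1 - ?a) * x = - petal_flux p ?a * x"
      by (simp add: d petal_flux_def algebra_simps power2_eq_square)
    moreover have "A * wave w s = A * flux w s + d" "B * wave w t = B * flux w t + d"
      using m by (auto simp: flux_def algebra_simps)
    ultimately show "3 * ?g (s + 1) - ?g s - ?g (s + 2) - ?g (s + t + 2) = ?a * ?g (s + 1)"
      using m(3) unfolding center by (simp only: algebra_simps)
  next
    have g12: "?g (s + t + 1) = B * wave w 1" "?g (s + t) = B * wave w 2"
      using right[of "s + t + 1"] right[of "s + t"] t by simp_all
    have "?g (s + t + 1) - ?g (s + t) = B * (wave w 1 - wave w 2)"
      unfolding g12 by (rule right_diff_distrib[symmetric])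
    also have "\<dots> = ?a * ?g (s + t + 1)" unfolding bd g12 by (rule mult.left_commute)
    finally show "?g (s + t + 1) - ?g (s + t) = ?a * ?g (s + t + 1)" .
  next
    have sum: "(\<Sum>w = s + t + 3..s + t + 2 + p. ?g w) = real p * x"
      by (simp add: petal)
    have gd: "?g (s + 1) = d" using m by (simp add: left)
    show "real (p + 1) * ?g (s + t + 2) - ?g (s + 1) - (\<Sum>w = s + t + 3..s + t + 2 + p. ?g w)
        = ?a * ?g (s + t + 2)"
      unfolding sum gd center d by (simp add: algebra_simps power2_eq_square)
  next
    fix j assume "1 \<le> j \<and> j \<le> p"
    then show "?g (s + t + 2 + j) - ?g (s + t + 2) = ?a * ?g (s + t + 2 + j)"
      unfolding center by (simp add: petal algebra_simps)
  qed
qed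

text \<open>The two arms are solved by \<open>path_recurrence_solution\<close>. Away from eigenvalue
  \<open>1\<close> the petal equation determines every petal from the centre; at \<open>1\<close> it
  would only force the centre to vanish and allow different petal values.\<close>

lemma rose_eigen_mode:
  assumes s: "1 \<le> s" and t: "1 \<le> t" and p: "1 \<le> p"
    and w: "0 \<le> w" "w < pi" and a1: "freq_eigenvalue w \<noteq> 1"
    and g: "rose_eigen s t p (freq_eigenvalue w) g"
  obtains A B x where "rose_match s t p w A B x"
    and "\<And>k. 1 \<le> k \<Longrightarrow> k \<le> s + t + 2 + p \<Longrightarrow> g k = rose_mode s t w A B x k"
proof
  let ?a = "freq_eigenvalue w"
  define A where "A = g 1 / cos (w / 2)"
  define B where "B = g (s + t + 1) / cos (w / 2)"
  define x where "x = g (s + t + 3)"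
  define d where "d = petal_den p ?a * x"
  have d: "d = (1 - ?a)\<^sup>2 * x - real p * ?a * x" by (simp add: d_def petal_den_def algebra_simps)
  note e = g[unfolded rose_eigen_def]
  have left: "g k = A * wave w k" if "1 \<le> k" "k \<le> s + 1" for k
    unfolding A_def
    by (rule path_recurrence_solution[where m = s and f = g, OF _ _ w])
      (use e that s in auto)
  have right': "g (s + t + 2 - k) = B * wave w k" if "1 \<le> k" "k \<le> t + 1" for k
  proof -
    have "g (s + t + 2 - k) = g (s + t + 2 - 1) / cos (w / 2) * wave w k"
    \<comment> \<open>The second arm is read from its own free end and satisfies the recurrence in
      the reversed variable.\<close>
    proof (rule path_recurrence_solution[where m = t and f = "\<lambda>j. g (s + t + 2 - j)", OF _ _ w that t])
      show "g (s + t + 2 - 1) - g (s + t + 2 - 2) = ?a * g (s + t + 2 - 1)"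
        using e by simp
      fix i assume i: "2 \<le> i" "i \<le> t"
      then have k: "s + t + 2 - (i - 1) = (s + t + 2 - i) + 1" "s + t + 2 - (i + 1) = (s + t + 2 - i) - 1"
         "2 \<le> s + t + 2 - i" "s + t + 2 - i \<le> s + t" "s + t + 2 - i \<noteq> s + 1"
        by auto
      have "2 * g (s + t + 2 - i) - g ((s + t + 2 - i) - 1) - g ((s + t + 2 - i) + 1) = ?a * g (s + t + 2 - i)"
        using e k(3-5) by blast
      then show "2 * g (s + t + 2 - i) - g (s + t + 2 - (i - 1)) - g (s + t + 2 - (i + 1)) = ?a * g (s + t + 2 - i)"
        unfolding k(1,2) by linarith
    qed
    then show ?thesis by (simp add: B_def)
  qed
  have petal: "g (s + t + 2 + j) = x" if "1 \<le> j" "j \<le> p" for j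
  proof -
    have "g (s + t + 2 + i) = g (s + t + 2) / (1 - ?a)" if "1 \<le> i" "i \<le> p" for i
    proof -
      have "g (s + t + 2 + i) - g (s + t + 2) = ?a * g (s + t + 2 + i)" using e that by blast
      then have "(1 - ?a) * g (s + t + 2 + i) = g (s + t + 2)" by (simp add: algebra_simps)
      then show ?thesis using a1 by (simp add: nonzero_eq_divide_eq mult.commute)
    qed
    from this[OF that] this[of 1] p show ?thesis by (simp add: x_def numeral_3_eq_3)
  qed
  have center: "g (s + t + 2) = (1 - ?a) * x"
  proof -
    have "g (s + t + 2 + 1) - g (s + t + 2) = ?a * g (s + t + 2 + 1)"
      using e p by blast
    then show ?thesis using petal[of 1] p by (simp add: algebra_simps)
  qed
  have petal': "g k = x" if "s + t + 2 < k" "k \<le> s + t + 2 + p" for k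
  proof -
    have "k = s + t + 2 + (k - (s + t + 2))" using that by simp
    then show ?thesis using petal[of "k - (s + t + 2)"] that by simp
  qed
  have "(\<Sum>w = s + t + 3..s + t + 2 + p. g w) = (\<Sum>w = s + t + 3..s + t + 2 + p. x)"
    by (intro sum.cong) (auto intro: petal')
  then have "real (p + 1) * ((1 - ?a) * x) - g (s + 1) - real p * x = ?a * ((1 - ?a) * x)"
    using e center by simp
  then have gd: "g (s + 1) = d" by (simp add: d algebra_simps power2_eq_square)
  have Ad: "A * wave w (s + 1) = d" and Bd: "B * wave w (t + 1) = d"
    using left[of "s + 1"] right'[of "t + 1"] gd by (auto simp: add.commute)
  have "g s = A * flux w s + d" "g (s + 2) = B * flux w t + d"
    using left[of s] right'[of t] s t Ad Bd by (auto simp: flux_def algebra_simps)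
  moreover have "3 * g (s + 1) - g s - g (s + 2) - g (s + t + 2) = ?a * g (s + 1)"
    using e by blast
  moreover have "d - (1 - ?a) * x = - petal_flux p ?a * x"
    by (simp add: d petal_flux_def algebra_simps power2_eq_square)
  ultimately show "rose_match s t p w A B x"
    using Ad Bd gd center unfolding rose_match_def Let_def d_def[symmetric]
    by (simp add: algebra_simps)
  show "g k = rose_mode s t w A B x k" if "1 \<le> k" "k \<le> s + t + 2 + p" for k
    using that left[of k] right'[of "s + t + 2 - k"] center petal'[of k]
    by (auto simp: rose_mode_def)
qed

section \<open>Distances in the Rose tree\<close>

lemma graph_distance_le:
  assumes "pre_digraph.awalk (with_proj G) u q v"
    and "pair_graph G"
  shows "graph_distance G u v \<le> ereal (length q)"
proof -
  interpret pair_graph G by fact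
  have "awalk_cost (\<lambda>_. 1) q = real (length q)"
    by (simp add: awalk_cost_def sum_list_triv)
  then show ?thesis
    using min_cost_le_walk_cost[OF assms(1), of "\<lambda>_. 1"] by (simp add: graph_distance_def)
qed

lemma graph_distance_refl:
  assumes "pair_graph G" "u \<in> pverts G"
  shows "graph_distance G u u \<le> 0"
proof -
  interpret pair_graph G by fact
  have "awalk u [] u" using assms(2) by (simp add: awalk_Nil_iff)
  from graph_distance_le[OF this assms(1)] show ?thesis by (simp add: zero_ereal_def)
qed

lemma graph_distance_arc:
  assumes "pair_graph G" "(u, v) \<in> parcs G"
  shows "graph_distance G u v \<le> 1"
proof -
  interpret pair_graph G by fact
  have "awalk u [(u, v)] v"
    using assms(2) by (auto simp: awalk_Cons_iff awalk_Nil_iff dest: in_arcsD2)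
  from graph_distance_le[OF this assms(1)] show ?thesis by (simp add: one_ereal_def)
qed

text \<open>Walks are concatenated and the two infima are moved out of the sum. That needs nonempty
  sets of walks, so the case where the right-hand side is infinite is treated apart.\<close>

lemma graph_distance_triangle:
  assumes "pair_graph G"
  shows "graph_distance G u w \<le> graph_distance G u v + graph_distance G v w"
proof -
  interpret pair_graph G by fact
  define W where "W x y = {q. awalk x q y}" for x y
  have \<mu>: "graph_distance G x y = (INF q\<in>W x y. ereal (length q))" for x y
    by (simp add: graph_distance_def \<mu>_def W_def awalk_cost_def sum_list_triv)
  have nonneg: "0 \<le> graph_distance G x y" for x y
    unfolding \<mu> by (intro INF_greatest) simp
  show ?thesis
  proof (cases "W u v = {} \<or> W v w = {}")
    case True
    then have "graph_distance G u v = \<infinity> \<or> graph_distance G v w = \<infinity>"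
      by (auto simp: \<mu> top_ereal_def)
    then show ?thesis using nonneg[of u v] nonneg[of v w] by auto
  next
    case False
    have "graph_distance G u w \<le> ereal (length q) + ereal (length r)"
      if "q \<in> W u v" "r \<in> W v w" for q r
    proof -
      have "awalk u (q @ r) w"
        using that awalk_appendI unfolding W_def by blast
      from graph_distance_le[OF this assms] show ?thesis by simp
    qed
    then have "graph_distance G u w \<le> (INF q\<in>W u v. INF r\<in>W v w. ereal (length q) + ereal (length r))"
      by (intro INF_greatest)
    also have "\<dots> = (INF q\<in>W u v. ereal (length q) + graph_distance G v w)"
      unfolding \<mu> using False by (intro INF_cong refl INF_ereal_add_right) auto
    also have "\<dots> = graph_distance G u v + graph_distance G v w"
      unfolding \<mu>[of u v] using False nonneg[of v w] by (intro INF_ereal_add_left) auto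
    finally show ?thesis .
  qed
qed

lemma graph_distance_step:
  assumes "pair_graph G" "graph_distance G u v \<le> ereal k" "(v, w) \<in> parcs G"
  shows "graph_distance G u w \<le> ereal (k + 1)"
proof -
  have "graph_distance G u w \<le> graph_distance G u v + graph_distance G v w"
    by (rule graph_distance_triangle[OF assms(1)])
  also have "\<dots> \<le> ereal k + 1"
    by (intro add_mono assms(2) graph_distance_arc[OF assms(1,3)])
  finally show ?thesis by (simp add: one_ereal_def)
qed

text \<open>Summing the bound along a walk telescopes; this is the source of lower bounds for
  distances.\<close>

lemma graph_distance_ge_potential:
  fixes f :: "'a \<Rightarrow> real"
  assumes G: "pair_graph G" and f: "\<And>u v. (u, v) \<in> parcs G \<Longrightarrow> f v - f u \<le> 1"
  shows "ereal (f v - f u) \<le> graph_distance G u v"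
proof -
  interpret pair_graph G by fact
  have "f v - f u \<le> real (length q)" if "awalk u q v" for q
    using that
  proof (induction q arbitrary: u)
    case (Cons e q)
    then have e: "(u, snd e) \<in> parcs G" "awalk (snd e) q v"
      by (auto simp: awalk_Cons_iff)
    have "f v - f (snd e) \<le> real (length q)" by (rule Cons.IH[OF e(2)])
    moreover have "f (snd e) - f u \<le> 1" by (rule f[OF e(1)])
    ultimately show ?case by simp
  qed (auto simp: awalk_Nil_iff)
  then show ?thesis
    unfolding graph_distance_def \<mu>_def
    by (intro INF_greatest) (auto simp: awalk_cost_def sum_list_triv)
qed

lemma rose_path_distance:
  assumes "1 \<le> i" "i + d \<le> s + t + 1"
  shows "graph_distance (rose_tree s t p) i (i + d) \<le> ereal d"
    and "graph_distance (rose_tree s t p) (i + d) i \<le> ereal d"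
proof -
  note G = pair_graph_rose_tree[of s t p]
  show "graph_distance (rose_tree s t p) i (i + d) \<le> ereal d"
    using assms
  proof (induction d)
    case 0
    then show ?case using graph_distance_refl[OF G, of i] by (simp add: rose_tree_def zero_ereal_def)
  next
    case (Suc d)
    then have "(i + d, i + Suc d) \<in> parcs (rose_tree s t p)" by (simp add: rose_arc_iff)
    from graph_distance_step[OF G Suc.IH this] Suc.prems show ?case by (simp add: add.commute)
  qed
  show "graph_distance (rose_tree s t p) (i + d) i \<le> ereal d"
    using assms
  proof (induction d arbitrary: i)
    case 0
    then show ?case using graph_distance_refl[OF G, of i] by (simp add: rose_tree_def zero_ereal_def)
  next
    case (Suc d)
    then have "(Suc i, i) \<in> parcs (rose_tree s t p)" by (simp add: rose_arc_iff)
    from graph_distance_step[OF G Suc.IH[of "Suc i"] this] Suc.prems show ?case by (simp add: add.commute)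
  qed
qed

text \<open>Projection to the path formed by the two arms; \<open>rose_height\<close> counts the
  steps down to that path.\<close>

definition rose_foot :: "nat \<Rightarrow> nat \<Rightarrow> nat \<Rightarrow> nat" where
  "rose_foot s t u = (if u \<le> s + t + 1 then u else s + 1)"

definition rose_height :: "nat \<Rightarrow> nat \<Rightarrow> nat \<Rightarrow> nat" where
  "rose_height s t u = (if u \<le> s + t + 1 then 0 else if u = s + t + 2 then 1 else 2)"

lemma rose_foot_distance:
  assumes "1 \<le> u" "u \<le> s + t + 2 + p"
  shows "graph_distance (rose_tree s t p) u (rose_foot s t u) \<le> ereal (rose_height s t u)"
    and "graph_distance (rose_tree s t p) (rose_foot s t u) u \<le> ereal (rose_height s t u)"
proof -
  note G = pair_graph_rose_tree[of s t p]
  let ?d = "graph_distance (rose_tree s t p)"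
  have refl: "?d v v \<le> ereal 0" if "1 \<le> v" "v \<le> s + t + 2 + p" for v
    using graph_distance_refl[OF G, of v] that by (simp add: rose_tree_def zero_ereal_def)
  have c: "(s + 1, s + t + 2) \<in> parcs (rose_tree s t p)" "(s + t + 2, s + 1) \<in> parcs (rose_tree s t p)"
    by (simp_all add: rose_arc_iff)
  have l: "(s + t + 2, u) \<in> parcs (rose_tree s t p)" "(u, s + t + 2) \<in> parcs (rose_tree s t p)"
    if "s + t + 2 < u"
    using that assms by (simp_all add: rose_arc_iff)
  have 1: "?d (s + 1) (s + t + 2) \<le> ereal (0 + 1)" "?d (s + t + 2) (s + 1) \<le> ereal (0 + 1)"
    using graph_distance_step[OF G refl c(1)] graph_distance_step[OF G refl c(2)] by auto
  have 2: "?d (s + 1) u \<le> ereal (0 + 1 + 1)" "?d u (s + 1) \<le> ereal (0 + 1 + 1)" if "s + t + 2 < u"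
    using graph_distance_step[OF G 1(1) l(1)[OF that]]
      graph_distance_step[OF G graph_distance_step[OF G refl l(2)[OF that]] c(2)] assms by auto
  show "?d u (rose_foot s t u) \<le> ereal (rose_height s t u)"
       "?d (rose_foot s t u) u \<le> ereal (rose_height s t u)"
    using refl[OF assms] 1 2 by (auto simp: rose_foot_def rose_height_def)
qed

lemma rose_distance_le:
  assumes u: "1 \<le> u" "u \<le> s + t + 2 + p" and v: "1 \<le> v" "v \<le> s + t + 2 + p"
  shows "graph_distance (rose_tree s t p) u v
    \<le> ereal (real (rose_height s t u) + \<bar>real (rose_foot s t u) - real (rose_foot s t v)\<bar>
        + real (rose_height s t v))"
proof -
  note tri = graph_distance_triangle[OF pair_graph_rose_tree[of s t p]]
  let ?d = "graph_distance (rose_tree s t p)" and ?f = "rose_foot s t" and ?h = "rose_height s t"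
  have f: "1 \<le> ?f w" "?f w \<le> s + t + 1" if "1 \<le> w" for w
    using that by (auto simp: rose_foot_def)
  have "?d (?f u) (?f v) \<le> ereal \<bar>real (?f u) - real (?f v)\<bar>"
  proof (cases "?f u \<le> ?f v")
    case True
    then show ?thesis
      using rose_path_distance(1)[of "?f u" "?f v - ?f u" s t p] f[OF u(1)] f[OF v(1)]
      by (simp add: of_nat_diff abs_of_nonpos)
  next
    case False
    then show ?thesis
      using rose_path_distance(2)[of "?f v" "?f u - ?f v" s t p] f[OF u(1)] f[OF v(1)]
      by (simp add: of_nat_diff abs_if)
  qed
  then have "?d u v \<le> ereal (?h u) + (ereal \<bar>real (?f u) - real (?f v)\<bar> + ereal (?h v))"
    by (intro order_trans[OF tri[of u v "?f u"]] add_mono order_trans[OF tri[of "?f u" v "?f v"]]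
        rose_foot_distance u v)
  then show ?thesis by (simp add: add.assoc)
qed

lemma rose_end_distance:
  shows "graph_distance (rose_tree s t p) 1 (s + t + 1) = ereal (s + t)"
    and "graph_distance (rose_tree s t p) (s + t + 1) 1 = ereal (s + t)"
proof -
  note G = pair_graph_rose_tree[of s t p]
  let ?d = "graph_distance (rose_tree s t p)" and ?f = "\<lambda>u. real (rose_foot s t u)"
  \<comment> \<open>The foot serves as the potential: it changes by one along the path and not at
    all on arcs at the centre. Its negative handles the opposite direction.\<close>
  have f: "?f v - ?f u \<le> 1" "- ?f v - - ?f u \<le> 1" if "(u, v) \<in> parcs (rose_tree s t p)" for u v
    using that by (auto simp: rose_arc_iff rose_foot_def)
  have "ereal (?f (s + t + 1) - ?f 1) \<le> ?d 1 (s + t + 1)"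
    by (rule graph_distance_ge_potential[OF G f(1)])
  moreover have "ereal (- ?f 1 - - ?f (s + t + 1)) \<le> ?d (s + t + 1) 1"
    by (rule graph_distance_ge_potential[OF G, of "\<lambda>v. - ?f v"]) (rule f(2))
  ultimately show "?d 1 (s + t + 1) = ereal (s + t)" "?d (s + t + 1) 1 = ereal (s + t)"
    using rose_path_distance[of 1 "s + t" s t p]
    by (auto simp: rose_foot_def intro!: antisym)
qed

text \<open>Both arms have length at least three. Two petals are within distance four, and a petal
  and an end within \<open>max s t + 2\<close>, both below \<open>s + t\<close>.\<close>

lemma rose_distance_lt:
  assumes st: "3 \<le> s" "3 \<le> t" and u: "1 \<le> u" "u \<le> s + t + 2 + p" and v: "1 \<le> v" "v \<le> s + t + 2 + p"
    and ends: "{u, v} \<noteq> {1, s + t + 1}"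
  shows "graph_distance (rose_tree s t p) u v < ereal (s + t)"
proof -
  let ?f = "rose_foot s t" and ?h = "rose_height s t"
  have "real (?h u) + \<bar>real (?f u) - real (?f v)\<bar> + real (?h v) < real (s + t)"
  proof (cases "u \<le> s + t + 1 \<and> v \<le> s + t + 1")
    case True
    then have "\<not> (u = 1 \<and> v = s + t + 1)" "\<not> (v = 1 \<and> u = s + t + 1)" using ends by auto
    then have "int u - int v < int (s + t)" "int v - int u < int (s + t)"
      using True u v by auto
    then have "\<bar>real u - real v\<bar> < real (s + t)" by linarith
    then show ?thesis using True by (simp add: rose_foot_def rose_height_def)
  qed (use st u v in \<open>auto simp: rose_foot_def rose_height_def\<close>)
  then show ?thesis using rose_distance_le[OF u v] by (meson ereal_less_eq(3) less_ereal.simps(1) order_le_less_trans)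
qed

lemma rose_diameter:
  assumes st: "3 \<le> s" "3 \<le> t"
  shows "graph_diameter (rose_tree s t p) = ereal (s + t)"
  unfolding graph_diameter_def
proof (intro antisym SUP_least SUP_upper2[of "(1, s + t + 1)"])
  fix x assume "x \<in> pverts (rose_tree s t p) \<times> pverts (rose_tree s t p)"
  then have *: "1 \<le> fst x" "fst x \<le> s + t + 2 + p" "1 \<le> snd x" "snd x \<le> s + t + 2 + p"
    by (auto simp: rose_tree_def)
  show "(case x of (u, v) \<Rightarrow> graph_distance (rose_tree s t p) u v) \<le> ereal (s + t)"
  proof (cases "{fst x, snd x} = {1, s + t + 1}")
    case True
    then have "fst x = 1 \<and> snd x = s + t + 1 \<or> fst x = s + t + 1 \<and> snd x = 1"
      by (auto simp: doubleton_eq_iff)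
    then show ?thesis using rose_end_distance[of s t p] by (auto simp: case_prod_beta)
  next
    case False
    with rose_distance_lt[OF st * False] show ?thesis by (simp add: case_prod_beta)
  qed
qed (use rose_end_distance(1)[of s t p] in \<open>auto simp: rose_tree_def\<close>)

text \<open>Turns clause (ii) of (FED) into the demand that the extrema sit at the free ends of the
  two arms.\<close>

lemma rose_distance_eq_diameter_iff:
  assumes st: "3 \<le> s" "3 \<le> t" and u: "1 \<le> u" "u \<le> s + t + 2 + p" and v: "1 \<le> v" "v \<le> s + t + 2 + p"
  shows "graph_distance (rose_tree s t p) u v = graph_diameter (rose_tree s t p)
    \<longleftrightarrow> {u, v} = {1, s + t + 1}"
  using rose_distance_lt[OF st u v] rose_diameter[OF st, of p] rose_end_distance[of s t p]
  by (metis doubleton_eq_iff order_less_irrefl)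

section \<open>Dirichlet frequencies and the secular function\<close>

text \<open>The first positive zero of
  \<open>wave w (s + 1) = cos ((s + 1 / 2) * w)\<close>.\<close>

definition dirichlet_freq :: "nat \<Rightarrow> real" where
  "dirichlet_freq s = pi / (2 * real s + 1)"

lemma freq_eigenvalue_less_iff:
  assumes "0 \<le> v" "v \<le> pi" "0 \<le> w" "w \<le> pi"
  shows "freq_eigenvalue v < freq_eigenvalue w \<longleftrightarrow> v < w"
  using cos_mono_less_eq[OF assms(3,4,1,2)] by (simp add: freq_eigenvalue_def)

lemma freq_eigenvalue_le_iff:
  assumes "0 \<le> v" "v \<le> pi" "0 \<le> w" "w \<le> pi"
  shows "freq_eigenvalue v \<le> freq_eigenvalue w \<longleftrightarrow> v \<le> w"
  using freq_eigenvalue_less_iff[OF assms(3,4,1,2)] by (simp flip: not_less)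

lemma freq_eigenvalue_0 [simp]: "freq_eigenvalue 0 = 0"
  by (simp add: freq_eigenvalue_def)

lemma freq_eigenvalue_pos: "0 < w \<Longrightarrow> w \<le> pi \<Longrightarrow> 0 < freq_eigenvalue w"
  using freq_eigenvalue_less_iff[of 0 w] by simp

lemma freq_eigenvalue_less_1: "0 \<le> w \<Longrightarrow> w < pi / 3 \<Longrightarrow> freq_eigenvalue w < 1"
  using freq_eigenvalue_less_iff[of w "pi / 3"] by (simp add: freq_eigenvalue_def cos_60)

lemma freq_eigenvalue_surj:
  assumes "0 \<le> a" "a \<le> 4"
  obtains w where "0 \<le> w" "w \<le> pi" "freq_eigenvalue w = a"
proof
  show "0 \<le> arccos (1 - a / 2)" "arccos (1 - a / 2) \<le> pi"
    using assms by (auto intro: arccos_lbound arccos_ubound)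
  show "freq_eigenvalue (arccos (1 - a / 2)) = a"
    using assms by (simp add: freq_eigenvalue_def)
qed

text \<open>The eigenvalue is four times the squared sine of \<open>w / 2\<close>, and the mean
  value theorem gives \<open>sin y \<ge> y / 2\<close> while the cosine stays above
  \<open>1 / 2\<close>. The crude constant reappears in the bound on \<open>p\<close> for unequal
  arms.\<close>

lemma freq_eigenvalue_ge:
  assumes "0 \<le> w" "w \<le> pi / 3"
  shows "w\<^sup>2 / 4 \<le> freq_eigenvalue w"
proof (cases "w = 0")
  case False
  define y where "y = w / 2"
  have y: "0 < y" "y \<le> pi / 6" using assms False by (auto simp: y_def)
  obtain z where z: "0 < z" "z < y" "sin y - sin 0 = (y - 0) * cos z"
    using MVT2[OF y(1), of sin cos] by (auto intro: DERIV_sin)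
  have "1 / 2 \<le> cos z"
    using z y cos_monotone_0_pi_le[of z "pi / 3"] pi_gt_zero by (auto simp: cos_60)
  then have "y * (1 / 2) \<le> sin y"
    using z y by (simp add: mult_left_mono)
  then have "(y * (1 / 2))\<^sup>2 \<le> (sin y)\<^sup>2"
    using y by (intro power_mono) auto
  moreover have "freq_eigenvalue w = 4 * (sin y)\<^sup>2"
    using cos_double_sin[of y] by (simp add: freq_eigenvalue_def y_def)
  ultimately show ?thesis by (simp add: y_def power_divide power_mult_distrib)
qed simp

lemma cos_ge_quadratic: "1 - z\<^sup>2 / 2 \<le> cos (z :: real)"
proof -
  have "(sin (z / 2))\<^sup>2 \<le> (z / 2)\<^sup>2"
    using abs_sin_x_le_abs_x[of "z / 2"] by (metis abs_le_square_iff)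
  then show ?thesis
    using cos_double_sin[of "z / 2"] by (simp add: power_divide)
qed

lemma continuous_on_freq [continuous_intros]:
  "continuous_on X f \<Longrightarrow> continuous_on X (\<lambda>w. freq_eigenvalue (f w))"
  "continuous_on X f \<Longrightarrow> continuous_on X (\<lambda>w. wave (f w) k)"
  "continuous_on X f \<Longrightarrow> continuous_on X (\<lambda>w. flux (f w) k)"
  "continuous_on X f \<Longrightarrow> continuous_on X (\<lambda>w. petal_den p (f w))"
  "continuous_on X f \<Longrightarrow> continuous_on X (\<lambda>w. petal_flux p (f w))"
  for f :: "real \<Rightarrow> real"
  unfolding freq_eigenvalue_def wave_def flux_def petal_den_def petal_flux_def
  by (auto intro!: continuous_intros)

lemma dirichlet_freq_pos: "0 < dirichlet_freq s"
  by (simp add: dirichlet_freq_def)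

lemma dirichlet_freq_less_iff: "dirichlet_freq s < dirichlet_freq t \<longleftrightarrow> t < s"
  by (auto simp: dirichlet_freq_def divide_simps)

lemma dirichlet_freq_eq_iff: "dirichlet_freq s = dirichlet_freq t \<longleftrightarrow> t = s"
  using dirichlet_freq_less_iff[of s t] dirichlet_freq_less_iff[of t s] by (metis neq_iff)

lemma dirichlet_freq_lt:
  assumes "3 \<le> s"
  shows "dirichlet_freq s < pi / 6"
  using assms by (auto simp: dirichlet_freq_def divide_simps)

text \<open>Rescaling by the Dirichlet frequency sends the first zero to the phase
  \<open>pi / 2\<close>, so signs at the branch vertex can be read off from
  \<open>w / dirichlet_freq s\<close>.\<close>

lemma wave_end: "wave w (s + 1) = cos (w / dirichlet_freq s * (pi / 2))"
proof -
  have "(real (s + 1) - 1 / 2) * w = w / dirichlet_freq s * (pi / 2)"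
    using pi_gt_zero by (simp add: dirichlet_freq_def add_divide_distrib algebra_simps)
  then show ?thesis by (simp only: wave_def)
qed

lemma wave_dirichlet: "wave (dirichlet_freq s) (s + 1) = 0"
  using dirichlet_freq_pos[of s] unfolding wave_end by simp

lemma wave_end_pos: "0 \<le> w \<Longrightarrow> w < dirichlet_freq s \<Longrightarrow> 0 < wave w (s + 1)"
  unfolding wave_end using dirichlet_freq_pos[of s]
  by (intro cos_gt_zero_pi) (auto simp: field_simps intro: order_less_le_trans[of _ 0])

lemma wave_end_nonneg: "0 \<le> w \<Longrightarrow> w \<le> dirichlet_freq s \<Longrightarrow> 0 \<le> wave w (s + 1)"
  using wave_end_pos[of w s] wave_dirichlet[of s] by (cases "w = dirichlet_freq s") auto

lemma wave_end_eq_0: "0 \<le> w \<Longrightarrow> w \<le> dirichlet_freq s \<Longrightarrow> wave w (s + 1) = 0 \<Longrightarrow> w = dirichlet_freq s"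
  using wave_end_pos[of w s] by fastforce

lemma wave_end_nonpos:
  assumes "dirichlet_freq s \<le> w" "w \<le> 2 * dirichlet_freq s"
  shows "wave w (s + 1) \<le> 0"
proof -
  define r where "r = w / dirichlet_freq s"
  have "1 \<le> r" "r \<le> 2"
    using assms dirichlet_freq_pos[of s] by (auto simp: r_def field_simps)
  then have "0 \<le> - cos (r * (pi / 2))"
  proof -
    have "0 \<le> cos (r * (pi / 2) - pi)"
      using \<open>1 \<le> r\<close> \<open>r \<le> 2\<close> pi_gt_zero
        mult_right_mono[of 1 r "pi / 2"] mult_right_mono[of r 2 "pi / 2"]
      by (intro cos_ge_zero) linarith+
    then show ?thesis by (simp add: cos_diff)
  qed
  then show ?thesis unfolding wave_end r_def by simp
qed

text \<open>Up to the Dirichlet frequency the phases stay where the cosine strictly decreases, so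
  the wave still falls on its last step to the branch vertex.\<close>

lemma flux_pos:
  assumes "1 \<le> s" "0 < w" "w \<le> dirichlet_freq s"
  shows "0 < flux w s"
proof -
  have "2 * ((real s + 1 / 2) * w) \<le> pi"
    using assms(2,3) by (simp add: dirichlet_freq_def field_simps)
  then have "(real s + 1 / 2) * w \<le> pi"
    using pi_gt_zero by linarith
  then have "cos ((real s + 1 / 2) * w) < cos ((real s - 1 / 2) * w)"
    using assms pi_gt_zero mult_nonneg_nonneg[of "real s - 1 / 2" w]
    by (intro cos_monotone_0_pi mult_strict_right_mono) auto
  then show ?thesis by (simp add: flux_def wave_def add.commute)
qed

lemma petal_den_less:
  assumes "1 \<le> p" "0 \<le> a" "a < b" "b \<le> 1"
  shows "petal_den p b < petal_den p a"
proof -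
  have "(1 - b)\<^sup>2 \<le> (1 - a)\<^sup>2" using assms by (intro power_mono) auto
  moreover have "real p * a < real p * b" using assms by simp
  ultimately show ?thesis by (simp add: petal_den_def)
qed

lemma petal_flux_pos: "1 \<le> p \<Longrightarrow> 0 < a \<Longrightarrow> a \<le> 1 \<Longrightarrow> 0 < petal_flux p a"
  by (simp add: petal_flux_def)

lemma IVT_zero:
  fixes f :: "real \<Rightarrow> real"
  assumes "a \<le> b" "continuous_on {a..b} f" "0 \<le> f a" "f b \<le> 0"
  obtains x where "a \<le> x" "x \<le> b" "f x = 0"
  using IVT2'[of f b 0 a] assms by auto

text \<open>The equation at the branch vertex, cleared of the denominators \<open>wave w (s + 1)\<close>,
  \<open>wave w (t + 1)\<close> and \<open>petal_den p a\<close>; its zeros include the common zeros of two of these.\<close>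

definition secular :: "nat \<Rightarrow> nat \<Rightarrow> nat \<Rightarrow> real \<Rightarrow> real" where
  "secular s t p w = (let a = freq_eigenvalue w; D = petal_den p a in
     flux w s * wave w (t + 1) * D + wave w (s + 1) * flux w t * D
     + petal_flux p a * wave w (s + 1) * wave w (t + 1) + a * wave w (s + 1) * wave w (t + 1) * D)"

text \<open>The triple \<open>C' * D\<close>, \<open>C * D\<close>, \<open>C * C'\<close> satisfies
  the first two matching equations identically, and the third is the secular equation. If the triple
  vanishes, two of \<open>C\<close>, \<open>C'\<close>, \<open>D\<close> are zero and a mode living
  on the two corresponding branches remains.\<close>

lemma secular_zero_match:
  assumes "secular s t p w = 0"
  obtains A B x where "rose_match s t p w A B x" "A \<noteq> 0 \<or> B \<noteq> 0 \<or> x \<noteq> 0"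
proof -
  define a where "a = freq_eigenvalue w"
  define D where "D = petal_den p a"
  define N where "N = petal_flux p a"
  define C where "C = wave w (s + 1)"
  define C' where "C' = wave w (t + 1)"
  define S where "S = flux w s"
  define S' where "S' = flux w t"
  have match: "rose_match s t p w A B x \<longleftrightarrow>
     A * C = D * x \<and> B * C' = D * x \<and> A * S + B * S' + N * x + a * (D * x) = 0" for A B x
    by (simp add: rose_match_def Let_def a_def D_def N_def C_def C'_def S_def S'_def)
  have sec: "S * C' * D + C * S' * D + N * C * C' + a * C * C' * D = 0"
    using assms by (simp add: secular_def Let_def a_def D_def N_def C_def C'_def S_def S'_def)
  consider "C' * D \<noteq> 0 \<or> C * D \<noteq> 0 \<or> C * C' \<noteq> 0" | "C = 0" "C' = 0" | "C = 0" "D = 0" | "C' = 0" "D = 0"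
    by fastforce
  then show thesis
  proof cases
    case 1
    moreover have "(C' * D) * S + (C * D) * S' + N * (C * C') + a * (D * (C * C')) = 0"
      using sec by (simp add: algebra_simps)
    ultimately show ?thesis using that[of "C' * D" "C * D" "C * C'"] by (auto simp: match)
  next
    \<comment> \<open>Both arms vanish at the branch vertex: the amplitudes are chosen so that the
      fluxes cancel, or freely if both fluxes are zero. In the remaining cases the petals replace
      one arm.\<close>
    case 2
    then show ?thesis using that[of S' "- S" 0] that[of 1 0 0] by (cases "S = 0 \<and> S' = 0") (auto simp: match)
  next
    case 3
    then show ?thesis using that[of N 0 "- S"] that[of 1 0 0] by (cases "S = 0 \<and> N = 0") (auto simp: match)
  next
    case 4
    then show ?thesis using that[of 0 N "- S'"] that[of 0 1 0] by (cases "S' = 0 \<and> N = 0") (auto simp: match)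
  qed
qed

lemma rose_eigen_cong:
  assumes s: "1 \<le> s" and t: "1 \<le> t"
    and gh: "\<And>u. 1 \<le> u \<Longrightarrow> u \<le> s + t + 2 + p \<Longrightarrow> h u = g u" and e: "rose_eigen s t p a g"
  shows "rose_eigen s t p a h"
proof -
  have sum: "(\<Sum>w = s + t + 3..s + t + 2 + p. h w) = (\<Sum>w = s + t + 3..s + t + 2 + p. g w)"
    by (intro sum.cong refl gh) auto
  have i: "h i = g i" "h (i - 1) = g (i - 1)" "h (i + 1) = g (i + 1)"
    if "2 \<le> i \<and> i \<le> s + t \<and> i \<noteq> s + 1" for i
    using that by (auto intro!: gh)
  have j: "h (s + t + 2 + j) = g (s + t + 2 + j)" if "1 \<le> j \<and> j \<le> p" for j
    using that by (intro gh) auto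
  have single: "h 1 = g 1" "h 2 = g 2" "h (s + 1) = g (s + 1)" "h s = g s" "h (s + 2) = g (s + 2)"
    "h (s + t + 1) = g (s + t + 1)" "h (s + t) = g (s + t)" "h (s + t + 2) = g (s + t + 2)"
    using s t by (auto intro!: gh)
  have I: "(2 * h i - h (i - 1) - h (i + 1) = a * h i) \<longleftrightarrow> (2 * g i - g (i - 1) - g (i + 1) = a * g i)"
    if "2 \<le> i \<and> i \<le> s + t \<and> i \<noteq> s + 1" for i
    unfolding i[OF that] by (rule refl)
  have J: "(h (s + t + 2 + j) - g (s + t + 2) = a * h (s + t + 2 + j))
      \<longleftrightarrow> (g (s + t + 2 + j) - g (s + t + 2) = a * g (s + t + 2 + j))"
    if "1 \<le> j \<and> j \<le> p" for j
    unfolding j[OF that] by (rule refl)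
  show ?thesis
    using e unfolding rose_eigen_def sum single using I J by blast
qed

section \<open>Modes as eigenvectors of the Laplacian matrix\<close>

definition mode_vec :: "nat \<Rightarrow> nat \<Rightarrow> nat \<Rightarrow> real \<Rightarrow> real \<Rightarrow> real \<Rightarrow> real \<Rightarrow> real vec" where
  "mode_vec s t p w A B x = vec (s + t + 2 + p) (\<lambda>i. rose_mode s t w A B x (Suc i))"

lemma mode_vec_nth: "i < s + t + 2 + p \<Longrightarrow> mode_vec s t p w A B x $ i = rose_mode s t w A B x (Suc i)"
  by (simp add: mode_vec_def)

context
  fixes s t p :: nat
  assumes s: "1 \<le> s" and t: "1 \<le> t" and p: "1 \<le> p"
begin

lemma rose_mode_values:
  "rose_mode s t w A B x 1 = A * cos (w / 2)"
  "rose_mode s t w A B x (s + t + 1) = B * cos (w / 2)"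
  "rose_mode s t w A B x (s + t + 3) = x"
  using s t by (auto simp: rose_mode_def wave_def)

lemma laplacian_rose_carrier:
  "laplacian (rose_tree s t p) \<in> carrier_mat (s + t + 2 + p) (s + t + 2 + p)"
  using laplacian_carrier[OF pair_graph_rose_tree, of s t p] by (simp add: card_rose_tree)

lemma eigenvector_mode_vec:
  assumes "rose_match s t p w A B x" "A \<noteq> 0 \<or> B \<noteq> 0 \<or> x \<noteq> 0" and w: "0 \<le> w" "w < pi"
  shows "eigenvector (laplacian (rose_tree s t p)) (mode_vec s t p w A B x) (freq_eigenvalue w)"
proof -
  let ?n = "s + t + 2 + p" and ?v = "mode_vec s t p w A B x"
  have v: "?v \<in> carrier_vec ?n" by (simp add: mode_vec_def)
  have "rose_eigen s t p (freq_eigenvalue w) (\<lambda>u. ?v $ (u - 1))"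
    by (rule rose_eigen_cong[OF s t _ rose_mode_eigen[OF s t assms(1)]]) (simp add: mode_vec_nth)
  then have "laplacian (rose_tree s t p) *\<^sub>v ?v = freq_eigenvalue w \<cdot>\<^sub>v ?v"
    using rose_laplacian_eigen_iff[OF s t v] by blast
  moreover have "?v \<noteq> 0\<^sub>v ?n"
  proof
    assume 0: "?v = 0\<^sub>v ?n"
    have z: "rose_mode s t w A B x (Suc i) = 0" if "i < ?n" for i
      using mode_vec_nth[OF that, of w A B x] that unfolding 0 by simp
    have "cos (w / 2) \<noteq> 0" using w cos_gt_zero_pi[of "w / 2"] by auto
    then show False
      using z[of 0] z[of "s + t"] z[of "s + t + 2"] rose_mode_values[of w A B x] p assms(2)
      by (auto simp: numeral_3_eq_3)
  qed
  ultimately show ?thesis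
    using v laplacian_rose_carrier by (auto simp: eigenvector_def)
qed

lemma eigenvector_mode_vecE:
  assumes v: "v \<in> carrier_vec (s + t + 2 + p)"
    and e: "laplacian (rose_tree s t p) *\<^sub>v v = freq_eigenvalue w \<cdot>\<^sub>v v"
    and w: "0 \<le> w" "w < pi" "freq_eigenvalue w \<noteq> 1"
  obtains A B x where "rose_match s t p w A B x" "v = mode_vec s t p w A B x"
proof -
  have "rose_eigen s t p (freq_eigenvalue w) (\<lambda>u. v $ (u - 1))"
    using e rose_laplacian_eigen_iff[OF s t v] by simp
  then obtain A B x where *: "rose_match s t p w A B x"
    "\<And>k. 1 \<le> k \<Longrightarrow> k \<le> s + t + 2 + p \<Longrightarrow> v $ (k - 1) = rose_mode s t w A B x k"
    by (rule rose_eigen_mode[OF s t p w]) blast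
  have "v = mode_vec s t p w A B x"
  proof (rule eq_vecI)
    fix i assume "i < dim_vec (mode_vec s t p w A B x)"
    then show "v $ i = mode_vec s t p w A B x $ i"
      using *(2)[of "Suc i"] by (simp add: mode_vec_def)
  qed (use v in \<open>auto simp: mode_vec_def\<close>)
  with * that show thesis by blast
qed

lemma mode_vec_inject:
  assumes "mode_vec s t p w A B x = k \<cdot>\<^sub>v mode_vec s t p w A' B' x'" "0 \<le> w" "w < pi"
  shows "A = k * A'" "B = k * B'" "x = k * x'"
proof -
  let ?n = "s + t + 2 + p"
  have *: "rose_mode s t w A B x (Suc i) = k * rose_mode s t w A' B' x' (Suc i)" if "i < ?n" for i
    using arg_cong[OF assms(1), of "\<lambda>v. v $ i"] that by (simp add: mode_vec_def)
  have "cos (w / 2) \<noteq> 0" using assms cos_gt_zero_pi[of "w / 2"] by auto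
  then show "A = k * A'" "B = k * B'" "x = k * x'"
    using *[of 0] *[of "s + t"] *[of "s + t + 2"] rose_mode_values[of w A B x]
       rose_mode_values[of w A' B' x'] p
    by (auto simp: numeral_3_eq_3)
qed

text \<open>Connectedness enters through the explicit modes: at frequency \<open>0\<close> all waves
  equal one, and matching forces both amplitudes to equal the petal value.\<close>

lemma rose_laplacian_kernel:
  assumes v: "v \<in> carrier_vec (s + t + 2 + p)"
    and e: "laplacian (rose_tree s t p) *\<^sub>v v = 0\<^sub>v (s + t + 2 + p)"
  shows "\<exists>c. \<forall>i < s + t + 2 + p. v $ i = c"
proof -
  have "laplacian (rose_tree s t p) *\<^sub>v v = freq_eigenvalue 0 \<cdot>\<^sub>v v"
    using e v by auto
  then obtain A B x where *: "rose_match s t p 0 A B x" "v = mode_vec s t p 0 A B x"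
    using eigenvector_mode_vecE[OF v, of 0] pi_gt_zero by auto
  have "A = x" "B = x"
    using *(1) by (auto simp: rose_match_def Let_def wave_def petal_den_def)
  then have "v $ i = x" if "i < s + t + 2 + p" for i
    using that unfolding *(2) mode_vec_nth[OF that] by (simp add: rose_mode_def wave_def)
  then show ?thesis by blast
qed

text \<open>Any nonzero mode of positive frequency bounds the algebraic connectivity from above;
  monotonicity of \<open>freq_eigenvalue\<close> turns this into a bound on the frequency.\<close>

lemma rose_connectivity:
  assumes "rose_match s t p v A B x" "A \<noteq> 0 \<or> B \<noteq> 0 \<or> x \<noteq> 0" and v: "0 < v" "v < pi"
  shows "\<exists>w. 0 < w \<and> w \<le> v \<and> algebraic_connectivity (rose_tree s t p) = freq_eigenvalue w"
proof -
  let ?a = "algebraic_connectivity (rose_tree s t p)"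
  have ev: "eigenvalue (laplacian (rose_tree s t p)) (freq_eigenvalue u)"
    if "rose_match s t p u A B x" "A \<noteq> 0 \<or> B \<noteq> 0 \<or> x \<noteq> 0" "0 < u" "u < pi" for u A B x
    using eigenvector_mode_vec[OF that(1,2)] that(3,4) by (auto simp: eigenvalue_def)
  have fv: "0 < freq_eigenvalue v" using v freq_eigenvalue_pos by simp
  note * = algebraic_connectivity_least_positive[OF pair_graph_rose_tree, unfolded card_rose_tree,
      OF rose_laplacian_kernel ev[OF assms] fv]
  have "?a \<le> freq_eigenvalue v" using *(3)[OF _ _ ev[OF assms] fv] by blast
  moreover have "0 < ?a" using *(2) by blast
  moreover have "freq_eigenvalue v \<le> 4"
    using cos_ge_minus_one[of v] unfolding freq_eigenvalue_def by linarith
  ultimately obtain w where w: "0 \<le> w" "w \<le> pi" "freq_eigenvalue w = ?a"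
    using freq_eigenvalue_surj[of ?a] by auto
  have "w \<le> v" using w v \<open>?a \<le> freq_eigenvalue v\<close> freq_eigenvalue_le_iff[of w v] by simp
  moreover have "w \<noteq> 0" using w \<open>0 < ?a\<close> by auto
  ultimately show ?thesis using w by (intro exI[of _ w]) auto
qed

end

section \<open>The symmetric Rose tree\<close>

lemma unique_arg_min_less:
  fixes f :: "nat \<Rightarrow> real"
  assumes "{i. is_arg_min f P i} = {m}"
  shows "P m" and "\<And>i. P i \<Longrightarrow> i \<noteq> m \<Longrightarrow> f m < f i"
proof -
  have m: "is_arg_min f P m" using assms by blast
  then show "P m" by (simp add: is_arg_min_def)
  fix i assume i: "P i" "i \<noteq> m"
  then have "\<not> is_arg_min f P i" using assms by blast
  with i m show "f m < f i" unfolding is_arg_min_def by (meson not_less order_trans less_le_not_le)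
qed

lemma unique_arg_max_greater:
  fixes f :: "nat \<Rightarrow> real"
  assumes "{i. is_arg_max f P i} = {m}"
  shows "P m" and "\<And>i. P i \<Longrightarrow> i \<noteq> m \<Longrightarrow> f i < f m"
proof -
  have m: "is_arg_max f P m" using assms by blast
  then show "P m" by (simp add: is_arg_max_def)
  fix i assume i: "P i" "i \<noteq> m"
  then have "\<not> is_arg_max f P i" using assms by blast
  with i m show "f i < f m" unfolding is_arg_max_def by (meson not_less order_trans less_le_not_le)
qed

section \<open>Fiedler vectors as modes and necessary conditions for (FED)\<close>

context
  fixes s t p :: nat and w :: real
  assumes s: "3 \<le> s" and t: "3 \<le> t" and p: "1 \<le> p"
    and w: "0 < w" "w < pi / 3"
    and \<alpha>: "algebraic_connectivity (rose_tree s t p) = freq_eigenvalue w"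
begin

text \<open>Below frequency \<open>pi / 3\<close> the eigenvalue is less than \<open>1\<close>, so
  no eigenvector escapes the description by modes.\<close>

lemma fiedler_rose_iff:
  "fiedler_vector (rose_tree s t p) v \<longleftrightarrow>
    (\<exists>A B x. rose_match s t p w A B x \<and> (A \<noteq> 0 \<or> B \<noteq> 0 \<or> x \<noteq> 0) \<and> v = mode_vec s t p w A B x)"
proof -
  have st: "1 \<le> s" "1 \<le> t" using s t by auto
  have w': "0 \<le> w" "w < pi" "freq_eigenvalue w \<noteq> 1"
    using w freq_eigenvalue_less_1[of w] pi_gt_zero by auto
  note L = laplacian_rose_carrier[OF st p]
  show ?thesis
  proof
    assume "fiedler_vector (rose_tree s t p) v"
    then have v: "v \<in> carrier_vec (s + t + 2 + p)" "v \<noteq> 0\<^sub>v (s + t + 2 + p)"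
      "laplacian (rose_tree s t p) *\<^sub>v v = freq_eigenvalue w \<cdot>\<^sub>v v"
      using L by (auto simp: fiedler_vector_def eigenvector_def \<alpha>)
    obtain A B x where *: "rose_match s t p w A B x" "v = mode_vec s t p w A B x"
      by (rule eigenvector_mode_vecE[OF st p v(1,3) w'])
    moreover have "mode_vec s t p w 0 0 0 = 0\<^sub>v (s + t + 2 + p)"
      by (intro eq_vecI) (auto simp: mode_vec_def rose_mode_def)
    ultimately show "\<exists>A B x. rose_match s t p w A B x \<and> (A \<noteq> 0 \<or> B \<noteq> 0 \<or> x \<noteq> 0) \<and> v = mode_vec s t p w A B x"
      using v(2) by blast
  next
    assume "\<exists>A B x. rose_match s t p w A B x \<and> (A \<noteq> 0 \<or> B \<noteq> 0 \<or> x \<noteq> 0) \<and> v = mode_vec s t p w A B x"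
    then show "fiedler_vector (rose_tree s t p) v"
      using eigenvector_mode_vec[OF st p _ _ w'(1,2)] by (auto simp: fiedler_vector_def \<alpha>)
  qed
qed

text \<open>The necessary conditions that both refutations of (FED) contradict. The extrema sit at
  the free ends; comparison with the adjacent vertices gives \<open>A\<close> and \<open>B\<close>
  opposite signs, and comparison of end \<open>1\<close> with the first petal gives the bound on
  \<open>x\<close>.\<close>

lemma FED_rose_mode:
  assumes "FED (rose_tree s t p)"
  obtains A B x where "rose_match s t p w A B x" "A * B < 0" "x * A < A * A"
    "\<And>A' B' x'. rose_match s t p w A' B' x' \<Longrightarrow> \<exists>k. A' = k * A \<and> B' = k * B \<and> x' = k * x"
proof -
  let ?G = "rose_tree s t p" and ?n = "s + t + 2 + p"
  have st: "1 \<le> s" "1 \<le> t" using s t by auto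
  have w': "0 \<le> w" "w < pi" using w pi_gt_zero by auto
  have a: "0 < freq_eigenvalue w" using freq_eigenvalue_pos[of w] w w' by simp
  from assms obtain \<Phi> m M where uniq: "fiedler_vector_unique ?G" and fied: "fiedler_vector ?G \<Phi>"
    and m: "{i. is_arg_min (($) \<Phi>) (\<lambda>i. i < ?n) i} = {m}"
    and M: "{i. is_arg_max (($) \<Phi>) (\<lambda>i. i < ?n) i} = {M}"
    and dist: "graph_distance ?G (vertex_list ?G ! m) (vertex_list ?G ! M) = graph_diameter ?G"
    by (auto simp: FED_def card_rose_tree)
  note m = unique_arg_min_less[OF m] and M = unique_arg_max_greater[OF M]
  from fied obtain A B x where match: "rose_match s t p w A B x" and nz: "A \<noteq> 0 \<or> B \<noteq> 0 \<or> x \<noteq> 0"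
    and \<Phi>: "\<Phi> = mode_vec s t p w A B x"
    using fiedler_rose_iff by blast
  define g where "g = rose_mode s t w A B x"
  have g: "\<Phi> $ i = g (Suc i)" if "i < ?n" for i
    using mode_vec_nth[OF that] by (simp add: \<Phi> g_def)
  have "{Suc m, Suc M} = {1, s + t + 1}"
    using dist rose_distance_eq_diameter_iff[OF s t, of "Suc m" p "Suc M"] m(1) M(1)
    by (simp add: vertex_list_rose_tree)
  then have mM: "m = 0 \<and> M = s + t \<or> m = s + t \<and> M = 0"
    by (auto simp: doubleton_eq_iff)
  note val = rose_mode_values[OF st p, of w A B x, folded g_def]
  \<comment> \<open>At a free end the positive eigenvalue times the value is the difference to the
    neighbour, so a strict extremum there fixes the sign of the amplitude.\<close>
  have e: "g 1 - g 2 = freq_eigenvalue w * g 1"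
    "g (s + t + 1) - g (s + t) = freq_eigenvalue w * g (s + t + 1)"
    using rose_mode_eigen[OF st match] unfolding rose_eigen_def g_def by blast+
  have c: "0 < cos (w / 2)" using w' cos_gt_zero_pi[of "w / 2"] by auto
  \<comment> \<open>The end value is \<open>A * cos (w / 2)\<close>; as the cosine is at most one,
    the bound by the end value weakens to one by the amplitude.\<close>
  have "A * A * cos (w / 2) \<le> A * A" using mult_left_mono[of "cos (w / 2)" 1 "A * A"] by simp
  then have AA: "A * cos (w / 2) * A \<le> A * A" by (simp add: mult_ac)
  have "A * B < 0 \<and> x * A < A * A"
    using mM
  proof
    assume "m = 0 \<and> M = s + t"
    then have "g 1 < g 2" "g (s + t) < g (s + t + 1)" "g 1 < x"
      using m(2)[of 1] M(2)[of "s + t - 1"] m(2)[of "s + t + 2"] g s t p val(3)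
      by (auto simp: numeral_2_eq_2 numeral_3_eq_3)
    then have "freq_eigenvalue w * g 1 < 0" "0 < freq_eigenvalue w * g (s + t + 1)"
      using e by linarith+
    then have AB: "A < 0" "0 < B"
      using a c val by (auto simp: mult_less_0_iff zero_less_mult_iff)
    then have "x * A < A * cos (w / 2) * A"
      using \<open>g 1 < x\<close> val by (intro mult_strict_right_mono_neg) auto
    then have "x * A < A * A" using AA by (rule order_less_le_trans)
    then show ?thesis using AB by (auto simp: mult_less_0_iff)
  next
    assume "m = s + t \<and> M = 0"
    then have "g 2 < g 1" "g (s + t + 1) < g (s + t)" "x < g 1"
      using M(2)[of 1] m(2)[of "s + t - 1"] M(2)[of "s + t + 2"] g s t p val(3)
      by (auto simp: numeral_2_eq_2 numeral_3_eq_3)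
    then have "0 < freq_eigenvalue w * g 1" "freq_eigenvalue w * g (s + t + 1) < 0"
      using e by linarith+
    then have AB: "0 < A" "B < 0"
      using a c val by (auto simp: mult_less_0_iff zero_less_mult_iff)
    then have "x * A < A * cos (w / 2) * A"
      using \<open>x < g 1\<close> val by (intro mult_strict_right_mono) auto
    then have "x * A < A * A" using AA by (rule order_less_le_trans)
    then show ?thesis using AB by (auto simp: mult_less_0_iff)
  qed
  moreover have "\<exists>k. A' = k * A \<and> B' = k * B \<and> x' = k * x" if match': "rose_match s t p w A' B' x'" for A' B' x'
  proof (cases "A' \<noteq> 0 \<or> B' \<noteq> 0 \<or> x' \<noteq> 0")
    case True
    then have "fiedler_vector ?G (mode_vec s t p w A' B' x')"
      using match' fiedler_rose_iff by blast
    \<comment> \<open>Uniqueness only provides a common generator; proportionality to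
      \<open>\<Phi>\<close> follows by dividing the two factors.\<close>
    with uniq fied obtain \<Psi> k k' where k: "fiedler_vector ?G \<Psi>"
      "\<Phi> = k \<cdot>\<^sub>v \<Psi>" "mode_vec s t p w A' B' x' = k' \<cdot>\<^sub>v \<Psi>"
      unfolding fiedler_vector_unique_def by metis
    from k(1) obtain A0 B0 x0 where \<Psi>: "\<Psi> = mode_vec s t p w A0 B0 x0"
      using fiedler_rose_iff by blast
    have "A = k * A0" "B = k * B0" "x = k * x0" "A' = k' * A0" "B' = k' * B0" "x' = k' * x0"
      using mode_vec_inject[OF st p k(2)[unfolded \<Phi> \<Psi>] w'] mode_vec_inject[OF st p k(3)[unfolded \<Psi>] w']
      by simp_all
    moreover from this nz have "k \<noteq> 0" by auto
    ultimately show ?thesis by (intro exI[of _ "k' / k"]) auto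
  qed (auto intro: exI[of _ 0])
  ultimately show thesis using that[OF match] by blast
qed

end

text \<open>The real value of \<open>p\<close> at which \<open>petal_den\<close> vanishes at the
  Dirichlet frequency, that is, at which the lowest frequencies of the rose and of the arms
  coincide.\<close>

definition critical_petals :: "nat \<Rightarrow> real" where
  "critical_petals s = (let \<mu> = freq_eigenvalue (dirichlet_freq s) in (1 - \<mu>)\<^sup>2 / \<mu>)"

lemma less_critical_petals_iff:
  assumes "3 \<le> s"
  shows "real p < critical_petals s \<longleftrightarrow> 0 < petal_den p (freq_eigenvalue (dirichlet_freq s))"
proof -
  have "0 < freq_eigenvalue (dirichlet_freq s)"
    using dirichlet_freq_lt[OF assms] dirichlet_freq_pos[of s] pi_gt_zero
    by (intro freq_eigenvalue_pos) linarith+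
  then show ?thesis
    by (simp add: critical_petals_def Let_def petal_den_def pos_less_divide_eq)
qed

lemma freq_small:
  assumes "3 \<le> s" "0 < w" "w \<le> dirichlet_freq s"
  shows "w < pi / 3" "w < pi" "0 < freq_eigenvalue w" "freq_eigenvalue w < 1"
proof -
  show "w < pi / 3" "w < pi"
    using assms dirichlet_freq_lt[of s] pi_gt_zero by auto
  then show "0 < freq_eigenvalue w" "freq_eigenvalue w < 1"
    using assms freq_eigenvalue_pos[of w] freq_eigenvalue_less_1[of w] by auto
qed

text \<open>Below the critical number \<open>petal_den\<close> is positive up to
  \<open>\<theta>\<close>. A mode of smaller positive frequency would have equal amplitudes and a
  balance of positive terms, so only the antisymmetric wave is left; it falls strictly from the end
  towards the branch vertex and vanishes on centre and petals.\<close>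

lemma FED_symmetric_rose:
  assumes s: "3 \<le> s" and p: "1 \<le> p" and less: "real p < critical_petals s"
  shows "FED (rose_tree s s p)"
proof -
  let ?G = "rose_tree s s p" and ?n = "s + s + 2 + p"
  have s1: "1 \<le> s" using s by simp
  define \<theta> where "\<theta> = dirichlet_freq s"
  have \<theta>: "0 < \<theta>" "\<theta> < pi" using dirichlet_freq_pos[of s] freq_small[OF s] by (auto simp: \<theta>_def)
  have D\<theta>: "0 < petal_den p (freq_eigenvalue \<theta>)"
    using less less_critical_petals_iff[OF s] by (simp add: \<theta>_def)
  have C\<theta>: "wave \<theta> (s + 1) = 0" using wave_dirichlet by (simp add: \<theta>_def)
  have anti: "rose_match s s p \<theta> 1 (-1) 0"
    using C\<theta> by (simp add: rose_match_def Let_def)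
  obtain w where w: "0 < w" "w \<le> \<theta>" "algebraic_connectivity ?G = freq_eigenvalue w"
    using rose_connectivity[OF s1 s1 p anti _ \<theta>] by auto
  note small = freq_small[OF s w(1) w(2)[unfolded \<theta>_def]]
  note fied = fiedler_rose_iff[OF s s p w(1) small(1) w(3)]
  have D: "0 < petal_den p (freq_eigenvalue w)"
  proof (cases "w = \<theta>")
    case False
    then have "freq_eigenvalue w < freq_eigenvalue \<theta>"
      using w \<theta> freq_eigenvalue_less_iff[of w \<theta>] by simp
    moreover have "freq_eigenvalue \<theta> < 1" using freq_small(4)[OF s, of \<theta>] \<theta> by (simp add: \<theta>_def)
    ultimately show ?thesis
      using petal_den_less[OF p, of "freq_eigenvalue w" "freq_eigenvalue \<theta>"] D\<theta> small by simp
  qed (use D\<theta> in simp)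
  have S: "0 < flux w s" using flux_pos[OF s1 w(1)] w(2) by (simp add: \<theta>_def)
  have modes: "w = \<theta> \<and> B = - A \<and> x = 0"
    if match: "rose_match s s p w A B x" and nz: "A \<noteq> 0 \<or> B \<noteq> 0 \<or> x \<noteq> 0" for A B x
  proof -
    define a where "a = freq_eigenvalue w"
    define D where "D = petal_den p a"
    define N where "N = petal_flux p a"
    define C where "C = wave w (s + 1)"
    define S where "S = flux w s"
    have m: "A * C = D * x" "B * C = D * x" "A * S + B * S + N * x + a * (D * x) = 0"
      using match by (auto simp: rose_match_def Let_def a_def D_def N_def C_def S_def)
    have pos: "0 < D" "0 < S" "0 < N" "0 < a"
      using \<open>0 < petal_den p (freq_eigenvalue w)\<close> \<open>0 < flux w s\<close> petal_flux_pos[OF p small(3)] small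
      by (auto simp: D_def S_def N_def a_def)
    have "w = \<theta>"
    proof (rule ccontr)
      assume "w \<noteq> \<theta>"
      then have C: "0 < C" using wave_end_pos[of w s] w by (simp add: C_def \<theta>_def)
      have "A * C = B * C" using m by simp
      then have AB: "B = A" using C by simp
      have x: "x = A * (C / D)" using m(1) pos by (simp add: field_simps)
      have "A * (2 * S + N * (C / D) + a * C) = 0"
        using m(3) pos unfolding AB x by (simp add: field_simps)
      moreover have "0 < 2 * S + N * (C / D) + a * C"
        using pos C by (intro add_pos_pos mult_pos_pos divide_pos_pos) auto
      ultimately have "A = 0" by simp
      with AB x nz show False by simp
    qed
    moreover from this have "C = 0" using C\<theta> by (simp add: C_def)
    with m pos have "x = 0" by simp
    moreover from this m(3) have "(A + B) * S = 0" by (simp add: algebra_simps)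
    with pos have "B = - A" by simp
    ultimately show ?thesis by blast
  qed
  have w\<theta>: "w = \<theta>"
  proof -
    have "eigenvalue (laplacian ?G) (algebraic_connectivity ?G)"
      using algebraic_connectivity_least_positive(1)[OF pair_graph_rose_tree, unfolded card_rose_tree,
        OF rose_laplacian_kernel[OF s1 s1 p], of "freq_eigenvalue \<theta>"]
        eigenvector_mode_vec[OF s1 s1 p anti] \<theta> freq_small(3)[OF s, of \<theta>]
      by (auto simp: eigenvalue_def \<theta>_def)
    then obtain v where "fiedler_vector ?G v" by (auto simp: eigenvalue_def fiedler_vector_def)
    then show ?thesis using fied modes by blast
  qed
  define \<Phi> where "\<Phi> = mode_vec s s p \<theta> 1 (-1) 0"
  have \<Phi>: "fiedler_vector ?G \<Phi>"
    unfolding fied \<Phi>_def w\<theta> using anti by fastforce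
  have uniq: "fiedler_vector_unique ?G"
    unfolding fiedler_vector_unique_def
  proof (intro exI[of _ \<Phi>] conjI \<Phi> allI impI)
    fix \<Psi> assume "fiedler_vector ?G \<Psi>"
    then obtain A where "\<Psi> = mode_vec s s p \<theta> A (- A) 0"
      unfolding fied using modes w\<theta> by blast
    then have "\<Psi> = A \<cdot>\<^sub>v \<Phi>"
      by (intro eq_vecI) (auto simp: \<Phi>_def mode_vec_def rose_mode_def)
    then show "\<exists>k. \<Psi> = k \<cdot>\<^sub>v \<Phi>" by blast
  qed
  define h where "h = cos (\<theta> / 2)"
  have w1: "wave \<theta> 1 = h" by (simp add: wave_def h_def)
  have h: "0 < h" using \<theta> cos_gt_zero_pi[of "\<theta> / 2"] by (auto simp: h_def)
  \<comment> \<open>The phases run from \<open>\<theta> / 2\<close> at the end, which is excluded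
    here, to \<open>pi / 2\<close> at the branch vertex.\<close>
  have wave_bound: "0 \<le> wave \<theta> k \<and> wave \<theta> k < h" if "2 \<le> k" "k \<le> s + 1" for k
  proof -
    have "(real s + 1 / 2) * \<theta> = pi / 2" by (simp add: \<theta>_def dirichlet_freq_def field_simps)
    moreover have "(real k - 1 / 2) * \<theta> \<le> (real s + 1 / 2) * \<theta>"
      using that \<theta> by (intro mult_right_mono) auto
    moreover have "1 / 2 * \<theta> < (real k - 1 / 2) * \<theta>"
      using that \<theta> by (intro mult_strict_right_mono) auto
    ultimately have k: "\<theta> / 2 < (real k - 1 / 2) * \<theta>" "(real k - 1 / 2) * \<theta> \<le> pi / 2" by auto
    have "0 \<le> cos ((real k - 1 / 2) * \<theta>)" using k \<theta> pi_gt_zero by (intro cos_ge_zero) linarith+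
    moreover have "cos ((real k - 1 / 2) * \<theta>) < cos (\<theta> / 2)"
      using k \<theta> by (intro cos_monotone_0_pi) auto
    ultimately show ?thesis by (simp add: wave_def h_def)
  qed
  have val: "\<Phi> $ 0 = h" "\<Phi> $ (s + s) = - h"
    using mode_vec_nth[of 0 s s p \<theta> 1 "-1" 0] mode_vec_nth[of "s + s" s s p \<theta> 1 "-1" 0] s1 w1
    by (auto simp: \<Phi>_def rose_mode_def)
  have bound: "- h < \<Phi> $ i \<and> \<Phi> $ i < h" if i: "i < ?n" "i \<noteq> 0" "i \<noteq> s + s" for i
  proof -
    have *: "\<Phi> $ i = rose_mode s s \<theta> 1 (-1) 0 (Suc i)"
      using mode_vec_nth[OF i(1)] by (simp add: \<Phi>_def)
    consider "i \<le> s" | "s < i" "i < s + s" | "s + s < i" using i by linarith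
    then show ?thesis
    proof cases
      case 1
      then show ?thesis using * wave_bound[of "Suc i"] i h by (simp add: rose_mode_def)
    next
      case 2
      then have "2 \<le> s + s + 2 - Suc i" "s + s + 2 - Suc i \<le> s + 1" by auto
      from wave_bound[OF this] show ?thesis using 2 * h by (simp add: rose_mode_def)
    next
      case 3
      then show ?thesis using * h by (simp add: rose_mode_def)
    qed
  qed
  have le: "- h \<le> \<Phi> $ i \<and> \<Phi> $ i \<le> h" if "i < ?n" for i
    using bound[OF that] val h by (cases "i = 0 \<or> i = s + s") auto
  have "{i. is_arg_min (\<lambda>i. \<Phi> $ i) (\<lambda>i. i < ?n) i} = {s + s}"
  proof (intro equalityI subsetI)
    fix i assume "i \<in> {i. is_arg_min (\<lambda>i. \<Phi> $ i) (\<lambda>i. i < ?n) i}"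
    then have "i < ?n" "\<not> \<Phi> $ (s + s) < \<Phi> $ i" by (auto simp: is_arg_min_def)
    then have "i < ?n" "\<not> - h < \<Phi> $ i" using val(2) by auto
    then show "i \<in> {s + s}" using bound[of i] val(1) h by (cases "i = 0") auto
  next
    fix i assume "i \<in> {s + s}"
    moreover have "\<not> \<Phi> $ y < \<Phi> $ (s + s)" if "y < ?n" for y
      using le[OF that] unfolding val by linarith
    ultimately show "i \<in> {i. is_arg_min (\<lambda>i. \<Phi> $ i) (\<lambda>i. i < ?n) i}"
      by (auto simp: is_arg_min_def)
  qed
  moreover have "{i. is_arg_max (\<lambda>i. \<Phi> $ i) (\<lambda>i. i < ?n) i} = {0}"
  proof (intro equalityI subsetI)
    fix i assume "i \<in> {i. is_arg_max (\<lambda>i. \<Phi> $ i) (\<lambda>i. i < ?n) i}"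
    then have "i < ?n" "\<not> \<Phi> $ i < \<Phi> $ 0" by (auto simp: is_arg_max_def)
    then have "i < ?n" "\<not> \<Phi> $ i < h" using val(1) by auto
    then show "i \<in> {0}" using bound[of i] val(2) h by (cases "i = s + s") auto
  next
    fix i :: nat assume "i \<in> {0}"
    moreover have "\<not> \<Phi> $ 0 < \<Phi> $ y" if "y < ?n" for y
      using le[OF that] unfolding val by linarith
    ultimately show "i \<in> {i. is_arg_max (\<lambda>i. \<Phi> $ i) (\<lambda>i. i < ?n) i}"
      by (auto simp: is_arg_max_def)
  qed
  moreover have "graph_distance ?G (vertex_list ?G ! (s + s)) (vertex_list ?G ! 0) = graph_diameter ?G"
    using rose_distance_eq_diameter_iff[OF s s, of "s + s + 1" p 1]
    by (simp add: vertex_list_rose_tree insert_commute)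
  ultimately show ?thesis
    unfolding FED_def card_rose_tree using uniq \<Phi> by blast
qed

text \<open>From the critical number on, \<open>r \<le> \<theta>\<close> and a symmetric mode exists
  at a frequency between them. Exchanging the equal arms preserves Fiedler modes, so under (FED) the
  Fiedler mode would be antisymmetric with frequency \<open>\<theta>\<close>, and the symmetric mode
  would then share its eigenvalue.\<close>

lemma not_FED_symmetric_rose:
  assumes s: "3 \<le> s" and p: "1 \<le> p" and ge: "critical_petals s \<le> real p"
  shows "\<not> FED (rose_tree s s p)"
proof
  let ?G = "rose_tree s s p"
  assume FED: "FED ?G"
  have s1: "1 \<le> s" using s by simp
  define \<theta> where "\<theta> = dirichlet_freq s"
  have \<theta>: "0 < \<theta>" "\<theta> < pi" using dirichlet_freq_pos[of s] freq_small[OF s] by (auto simp: \<theta>_def)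
  let ?C = "\<lambda>w. wave w (s + 1)" and ?S = "\<lambda>w. flux w s" and ?a = freq_eigenvalue
  let ?D = "\<lambda>w. petal_den p (?a w)" and ?N = "\<lambda>w. petal_flux p (?a w)"
  \<comment> \<open>For equal arms \<open>secular\<close> is \<open>wave w (s + 1)\<close> times
    this factor, whose zeros carry the symmetric modes.\<close>
  define Q where "Q w = 2 * ?S w * ?D w + ?N w * ?C w + ?a w * ?C w * ?D w" for w
  have C\<theta>: "?C \<theta> = 0" unfolding \<theta>_def by (rule wave_dirichlet)
  have D\<theta>: "?D \<theta> \<le> 0"
    using ge less_critical_petals_iff[OF s, of p] by (simp add: \<theta>_def not_less)
  obtain r where r: "0 \<le> r" "r \<le> \<theta>" "?D r = 0"
    by (rule IVT_zero[of 0 \<theta> ?D]) (use \<theta> D\<theta> in \<open>auto intro!: continuous_intros simp: petal_den_def\<close>)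
  then have r0: "0 < r" by (cases "r = 0") (auto simp: petal_den_def)
  note r_small = freq_small[OF s r0 r(2)[unfolded \<theta>_def]]
  have Qr: "0 \<le> Q r"
    using r r0 wave_end_nonneg[of r s] petal_flux_pos[OF p r_small(3)] r_small
    by (simp add: Q_def \<theta>_def)
  have Q\<theta>: "Q \<theta> \<le> 0"
    using C\<theta> D\<theta> flux_pos[OF s1 \<theta>(1)] by (simp add: Q_def mult_nonneg_nonpos \<theta>_def)
  obtain u where u: "r \<le> u" "u \<le> \<theta>" "Q u = 0"
    by (rule IVT_zero[of r \<theta> Q]) (use r Qr Q\<theta> in \<open>auto intro!: continuous_intros simp: Q_def[abs_def]\<close>)
  have u0: "0 < u" using u r0 by simp
  have Su: "0 < ?S u" using flux_pos[OF s1 u0] u by (simp add: \<theta>_def)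
  have "\<exists>A x. rose_match s s p u A A x \<and> (A \<noteq> 0 \<or> x \<noteq> 0)"
  proof (cases "?D u = 0 \<and> ?C u = 0")
    case True
    \<comment> \<open>The generic symmetric mode would be zero here; instead the flux of both arms
      is balanced against the petals.\<close>
    then have "rose_match s s p u (?N u) (?N u) (- 2 * ?S u)"
      by (simp add: rose_match_def Let_def)
    then show ?thesis using Su by (intro exI[of _ "?N u"] exI[of _ "- 2 * ?S u"]) auto
  next
    case False
    have "rose_match s s p u (?D u) (?D u) (?C u)"
      using u(3) by (simp add: rose_match_def Let_def Q_def algebra_simps)
    then show ?thesis using False by (intro exI[of _ "?D u"] exI[of _ "?C u"]) auto
  qed
  then obtain A0 x0 where sym: "rose_match s s p u A0 A0 x0" "A0 \<noteq> 0 \<or> A0 \<noteq> 0 \<or> x0 \<noteq> 0" by blast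
  have "u < pi" using u \<theta> by simp
  obtain w where w: "0 < w" "w \<le> u" "algebraic_connectivity ?G = freq_eigenvalue w"
    using rose_connectivity[OF s1 s1 p sym u0 \<open>u < pi\<close>] by blast
  have w\<theta>: "w \<le> dirichlet_freq s" using w u by (simp add: \<theta>_def)
  note small = freq_small[OF s w(1) w\<theta>]
  obtain A B x where m: "rose_match s s p w A B x" "A * B < 0" "x * A < A * A"
    and uniq: "\<And>A' B' x'. rose_match s s p w A' B' x' \<Longrightarrow> \<exists>k. A' = k * A \<and> B' = k * B \<and> x' = k * x"
    using FED_rose_mode[OF s s p w(1) small(1) w(3) FED] by blast
  \<comment> \<open>The exchanged mode is proportional to the original; the ratio squares to one,
    and \<open>A * B < 0\<close> selects \<open>-1\<close>.\<close>
  have "rose_match s s p w B A x"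
    using m(1) by (simp add: rose_match_def Let_def algebra_simps)
  then obtain k where k: "B = k * A" "A = k * B" "x = k * x" using uniq by blast
  have "A \<noteq> 0" using m(2) by auto
  moreover have "(k * k) * A = 1 * A" using k(1,2) by (metis mult.assoc mult_1)
  ultimately have "k * k = 1" by (metis mult_cancel_right)
  moreover have "k * (A * A) < 0" using m(2) unfolding k(1) by (simp only: mult_ac)
  then have "k < 0" by (auto simp: mult_less_0_iff)
  ultimately have km: "k = -1" using square_eq_1_iff[of k] by auto
  then have "x = 0" "B = - A" using k by auto
  have "?C w = 0"
    using m(1,2) \<open>x = 0\<close> by (auto simp: rose_match_def Let_def)
  then have "w = \<theta>" using wave_end_eq_0[of w s] w w\<theta> by (simp add: \<theta>_def)
  then have "u = w" using w u by simp
  with sym uniq obtain l where "A0 = l * A" "A0 = l * B" "x0 = l * x" by blast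
  then have "l * (A + A) = 0" using \<open>B = - A\<close> by (simp add: algebra_simps)
  then have "l = 0" using m(2) by auto
  with \<open>A0 = l * A\<close> \<open>x0 = l * x\<close> sym show False by simp
qed

section \<open>The asymmetric Rose tree\<close>

text \<open>A zero of the secular function bounds the Fiedler frequency \<open>w\<close> by
  \<open>\<sigma>\<close> and by the larger of \<open>\<tau>\<close> and \<open>r\<close>. If
  \<open>petal_den\<close> is positive at \<open>w\<close>, the petals are at least as extreme as
  the amplitude of the first arm; otherwise matching excludes nonzero ends of opposite sign. Both
  contradict \<open>FED_rose_mode\<close>.\<close>

lemma not_FED_asymmetric_rose:
  assumes s: "3 \<le> s" and t: "3 \<le> t" and st: "s \<noteq> t" and p: "8 * (real s + 1)\<^sup>2 < real p"
  shows "\<not> FED (rose_tree s t p)"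
proof
  let ?G = "rose_tree s t p"
  assume FED: "FED ?G"
  have s1: "1 \<le> s" and t1: "1 \<le> t" using s t by auto
  have "0 < real p" using p zero_le_power2[of "real s + 1"] by linarith
  then have p1: "1 \<le> p" by simp
  define \<sigma> where "\<sigma> = dirichlet_freq s"
  define \<tau> where "\<tau> = dirichlet_freq t"
  let ?C = "\<lambda>w. wave w (s + 1)" and ?S = "\<lambda>w. flux w s"
  let ?C' = "\<lambda>w. wave w (t + 1)" and ?S' = "\<lambda>w. flux w t"
  let ?a = freq_eigenvalue
  let ?D = "\<lambda>w. petal_den p (?a w)" and ?N = "\<lambda>w. petal_flux p (?a w)"
  have pos: "0 < \<sigma>" "0 < \<tau>" by (simp_all add: \<sigma>_def \<tau>_def dirichlet_freq_pos)
  have small: "w < pi / 3" "w < pi" "0 < ?a w" "?a w < 1" if "0 < w" "w \<le> \<sigma>" for w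
    using freq_small[OF s] that by (auto simp: \<sigma>_def)
  have ne: "\<sigma> \<noteq> \<tau>" using st by (simp add: \<sigma>_def \<tau>_def dirichlet_freq_eq_iff)
  \<comment> \<open>The constant is \<open>8 = 2 * 4\<close>: the \<open>4\<close> compensates
    \<open>freq_eigenvalue_ge\<close>, and the \<open>2\<close> survives in front of the squared
    phase at the branch vertex.\<close>
  have z: "2 * (w / \<sigma> * (pi / 2))\<^sup>2 \<le> real p * ?a w" if "0 < w" "w \<le> \<sigma>" for w
  proof -
    have "w / \<sigma> * (pi / 2) = (real s + 1 / 2) * w"
      using pi_gt_zero by (simp add: \<sigma>_def dirichlet_freq_def field_simps)
    then have "2 * (w / \<sigma> * (pi / 2))\<^sup>2 = 2 * ((real s + 1 / 2)\<^sup>2 * w\<^sup>2)"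
      by (simp only: power_mult_distrib)
    also have "\<dots> \<le> 2 * ((real s + 1)\<^sup>2 * w\<^sup>2)"
      by (intro mult_left_mono mult_right_mono power_mono) auto
    also have "\<dots> = 8 * (real s + 1)\<^sup>2 * (w\<^sup>2 / 4)" by simp
    also have "\<dots> \<le> real p * ?a w"
      using p freq_eigenvalue_ge[of w] small[OF that] that by (intro mult_mono) auto
    finally show ?thesis .
  qed
  \<comment> \<open>At \<open>\<sigma>\<close> the phase is \<open>pi / 2\<close>, which is at least
    one, so \<open>real p * ?a \<sigma>\<close> is at least two and exceeds the square.\<close>
  have D\<sigma>: "?D \<sigma> < 0"
  proof -
    have "2 * (pi / 2)\<^sup>2 \<le> real p * ?a \<sigma>" using z[of \<sigma>] pos by simp
    moreover have "1\<^sup>2 \<le> (pi / 2)\<^sup>2" using pi_ge_two by (intro power_mono) auto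
    moreover have "(1 - ?a \<sigma>)\<^sup>2 \<le> 1\<^sup>2" using small[of \<sigma>] pos by (intro power_mono) auto
    ultimately show ?thesis by (simp add: petal_den_def power_divide)
  qed
  obtain r where r: "0 \<le> r" "r \<le> \<sigma>" "?D r = 0"
    by (rule IVT_zero[of 0 \<sigma> ?D]) (use pos D\<sigma> in \<open>auto intro!: continuous_intros simp: petal_den_def\<close>)
  have r0: "0 < r" using r by (cases "r = 0") (auto simp: petal_den_def)
  have r\<sigma>: "r < \<sigma>" using r D\<sigma> by (cases "r = \<sigma>") auto
  have Dmono: "?D w < ?D v" if "0 \<le> v" "v < w" "w \<le> \<sigma>" for v w
  proof (rule petal_den_less[OF p1])
    show "0 \<le> ?a v" by (simp add: freq_eigenvalue_def)
    show "?a v < ?a w" using that small[of w] freq_eigenvalue_less_iff[of v w] by simp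
    show "?a w \<le> 1" using small[of w] that by simp
  qed
  have Dpos: "0 < ?D w" if "0 \<le> w" "w < r" for w using Dmono[of w r] that r by simp
  have Dneg: "?D w < 0" if "r < w" "w \<le> \<sigma>" for w using Dmono[of r w] that r by simp
  have C: "0 < ?C w" if "0 \<le> w" "w < \<sigma>" for w using wave_end_pos[of w s] that by (simp add: \<sigma>_def)
  have C': "0 < ?C' w" if "0 \<le> w" "w < \<tau>" for w using wave_end_pos[of w t] that by (simp add: \<tau>_def)
  have C0: "?C \<sigma> = 0" "?C' \<tau> = 0" unfolding \<sigma>_def \<tau>_def by (rule wave_dirichlet)+
  have S: "0 < ?S w" if "0 < w" "w \<le> \<sigma>" for w using flux_pos[OF s1] that by (simp add: \<sigma>_def)
  have S': "0 < ?S' w" if "0 < w" "w \<le> \<tau>" for w using flux_pos[OF t1] that by (simp add: \<tau>_def)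
  have N: "0 < ?N w" if "0 < w" "w \<le> \<sigma>" for w using petal_flux_pos[OF p1] small[OF that] by simp
  let ?P = "secular s t p"
  have P: "?P w = ?S w * ?C' w * ?D w + ?C w * ?S' w * ?D w
     + ?N w * ?C w * ?C' w + ?a w * ?C w * ?C' w * ?D w" for w
    by (simp add: secular_def Let_def)
  have cont: "continuous_on X ?P" for X
    unfolding P[abs_def] by (intro continuous_intros)
  have "\<exists>u. 0 < u \<and> u \<le> \<sigma> \<and> u \<le> max \<tau> r \<and> ?P u = 0"
  proof (cases "\<tau> \<le> r")
    case True
    \<comment> \<open>\<open>?C'\<close> changes sign again at \<open>3 * \<tau>\<close>, which may lie below \<open>r\<close>.\<close>
    define e where "e = min r (2 * \<tau>)"
    have e: "\<tau> \<le> e" "e \<le> r" using True pos by (auto simp: e_def)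
    have "0 \<le> ?D \<tau>" using Dpos[of \<tau>] r True pos by (cases "\<tau> = r") auto
    then have "0 \<le> ?P \<tau>"
      using C[of \<tau>] S'[of \<tau>] True r\<sigma> pos C0 unfolding P by simp
    moreover have "?P e \<le> 0"
    proof (cases "r \<le> 2 * \<tau>")
      case True
      then have "e = r" by (simp add: e_def)
      moreover have "?C' r \<le> 0"
        using wave_end_nonpos[of t r] True \<open>\<tau> \<le> r\<close> by (simp add: \<tau>_def)
      moreover have "0 < ?N r * ?C r"
        using N[of r] C[of r] r0 r\<sigma> by simp
      ultimately show ?thesis unfolding P using r(3) by (simp add: mult_nonneg_nonpos)
    next
      case False
      then have e: "e = 2 * \<tau>" "0 < e" "e < r" "e < \<sigma>" using pos r\<sigma> by (auto simp: e_def)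
      \<comment> \<open>At twice the Dirichlet frequency the phase of the second arm is
        \<open>pi\<close> at the branch vertex and \<open>pi - e\<close> one step before.\<close>
      have C'e: "?C' e = -1"
        unfolding wave_end e(1) using pos by (simp add: \<tau>_def[symmetric])
      have "?S' e = cos (pi - e) + 1"
      proof -
        have "(real t - 1 / 2) * e = pi - e"
          using pos by (simp add: e \<tau>_def dirichlet_freq_def field_simps)
        then have "wave e t = cos (pi - e)" by (simp only: wave_def)
        then show ?thesis using C'e by (simp add: flux_def)
      qed
      then have S'e: "?S' e = ?a e / 2" by (simp add: freq_eigenvalue_def)
      \<comment> \<open>The flux of the second arm cancels only half of the last term of
        \<open>secular\<close>, so everything left is negative.\<close>
      have "?P e = - (?S e * ?D e) - ?C e * ?D e * (?a e / 2) - ?N e * ?C e"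
        unfolding P C'e S'e by (simp add: algebra_simps)
      moreover have "0 < ?S e * ?D e" "0 < ?C e * ?D e * (?a e / 2)" "0 < ?N e * ?C e"
        using S[of e] C[of e] N[of e] Dpos[of e] small(3)[of e] e by simp_all
      ultimately show ?thesis by linarith
    qed
    ultimately obtain u where "\<tau> \<le> u" "u \<le> e" "?P u = 0"
      by (rule IVT_zero[OF e(1) cont])
    then show ?thesis using e r\<sigma> pos by (intro exI[of _ u]) auto
  next
    case False
    \<comment> \<open>Now \<open>r < \<tau>\<close>. At \<open>r\<close> only the positive petal
      term survives; at the smaller Dirichlet frequency only an arm term, with negative
      \<open>petal_den\<close>.\<close>
    define e where "e = min \<tau> \<sigma>"
    have e: "r \<le> e" "e \<le> \<sigma>" "e \<le> \<tau>" using False r by (auto simp: e_def)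
    have "0 < ?N r * ?C r * ?C' r"
      using N[of r] C[of r] C'[of r] r0 r\<sigma> False by simp
    then have "0 \<le> ?P r" unfolding P using r(3) by simp
    moreover have "?P e \<le> 0"
    proof (cases "\<tau> < \<sigma>")
      case True
      then have "e = \<tau>" by (simp add: e_def)
      moreover have "?C \<tau> * ?S' \<tau> * ?D \<tau> \<le> 0"
        using C[of \<tau>] S'[of \<tau>] Dneg[of \<tau>] True False pos by (intro mult_nonneg_nonpos) auto
      ultimately show ?thesis unfolding P using C0 by simp
    next
      case f: False
      then have "e = \<sigma>" by (simp add: e_def)
      moreover have "?S \<sigma> * ?C' \<sigma> * ?D \<sigma> \<le> 0"
        using C'[of \<sigma>] S[of \<sigma>] D\<sigma> f ne pos by (intro mult_nonneg_nonpos) auto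
      ultimately show ?thesis unfolding P using C0 by simp
    qed
    ultimately obtain u where "r \<le> u" "u \<le> e" "?P u = 0"
      by (rule IVT_zero[OF e(1) cont])
    then show ?thesis using e r0 by (intro exI[of _ u]) auto
  qed
  then obtain u where u: "0 < u" "u \<le> \<sigma>" "u \<le> max \<tau> r" "?P u = 0" by blast
  obtain A0 B0 x0 where u_mode: "rose_match s t p u A0 B0 x0" "A0 \<noteq> 0 \<or> B0 \<noteq> 0 \<or> x0 \<noteq> 0"
    by (rule secular_zero_match[OF u(4)])
  obtain w where w: "0 < w" "w \<le> u" "algebraic_connectivity ?G = ?a w"
    using rose_connectivity[OF s1 t1 p1 u_mode u(1) small(2)[OF u(1,2)]] by blast
  have w\<sigma>: "w \<le> \<sigma>" using w u by simp
  obtain A B x where m: "rose_match s t p w A B x" "A * B < 0" "x * A < A * A"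
    by (rule FED_rose_mode[OF s t p1 w(1) small(1)[OF w(1) w\<sigma>] w(3) FED])
  have eq: "A * ?C w = ?D w * x" "B * ?C' w = ?D w * x"
    using m(1) by (auto simp: rose_match_def Let_def)
  have AA: "0 < A * A" using m(2) by (cases "A = 0") (auto simp: zero_less_mult_iff)
  show False
  proof (cases "0 < ?D w")
    case True
    have "?D w \<le> 1 - real p * ?a w"
    proof -
      have "(1 - ?a w)\<^sup>2 \<le> 1\<^sup>2" using small[OF w(1) w\<sigma>] by (intro power_mono) auto
      then show ?thesis by (simp add: petal_den_def)
    qed
    \<comment> \<open>With \<open>z\<close> the phase of the first arm at the branch vertex,
      \<open>1 - 2 * z^2 \<le> 1 - z^2 / 2 \<le> cos z\<close>.\<close>
    also have "\<dots> \<le> ?C w"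
      using z[OF w(1) w\<sigma>] cos_ge_quadratic[of "w / \<sigma> * (pi / 2)"]
        zero_le_power2[of "w / \<sigma> * (pi / 2)"]
      unfolding wave_end \<sigma>_def[symmetric] by linarith
    finally have "A * A * ?D w \<le> A * A * ?C w" using AA by (intro mult_left_mono) auto
    also have "\<dots> = x * A * ?D w" using eq(1) by (simp add: algebra_simps)
    finally have "A * A \<le> x * A" using True by (rule mult_right_le_imp_le)
    with m(3) show False by simp
  next
    case False
    then have rw: "r \<le> w" using Dpos[of w] w by (meson less_imp_le not_le)
    \<comment> \<open>The arms share the branch value. The left side is nonnegative, while for
      \<open>w \<le> \<tau>\<close> the right side is at most zero because
      \<open>A * B < 0\<close>.\<close>
    have key: "A * A * ?C w = A * B * ?C' w" using eq by (simp add: algebra_simps)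
    have Cw: "0 \<le> ?C w" using C[of w] C0 w w\<sigma> by (cases "w = \<sigma>") auto
    show False
    proof (cases "w \<le> \<tau>")
      case True
      then have "0 \<le> ?C' w" using C'[of w] C0 w by (cases "w = \<tau>") auto
      then have "A * B * ?C' w \<le> 0" using m(2) by (simp add: mult_nonpos_nonneg)
      moreover have "0 \<le> A * A * ?C w" using AA Cw by simp
      ultimately have "A * A * ?C w = 0" "A * B * ?C' w = 0" using key by linarith+
      then have "?C w = 0" "?C' w = 0" using AA m(2) by auto
      then have "w = \<sigma>" "w = \<tau>" using C[of w] C'[of w] w w\<sigma> True by fastforce+
      with ne show False by simp
    next
      case False
      \<comment> \<open>Beyond \<open>\<tau>\<close>, the bounds \<open>r \<le> w\<close> and
        \<open>w \<le> max \<tau> r\<close> leave only \<open>r\<close>, where the first arm would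
        have to vanish at the branch vertex.\<close>
      then have "w = r" using w u rw by auto
      then have "A * ?C r = 0" using eq r by simp
      with C[of r] r0 r\<sigma> AA show False by simp
    qed
  qed
qed

section \<open>Asymptotics of the threshold and choice of the two bounds\<close>

lemma critical_petals_asymp:
  "(\<lambda>s. critical_petals s - c) \<sim>[at_top] (\<lambda>s. 4 / pi\<^sup>2 * (real s)\<^sup>2)"
proof -
  have lim: "filterlim dirichlet_freq (at_right 0) at_top"
    unfolding dirichlet_freq_def[abs_def] using pi_gt_zero by real_asymp
  \<comment> \<open>Near zero \<open>freq_eigenvalue x\<close> behaves like \<open>x^2\<close>, so
    the quotient blows up like its inverse and absorbs the constant \<open>c\<close>.\<close>
  have "(\<lambda>x::real. (1 - freq_eigenvalue x)\<^sup>2 / freq_eigenvalue x - c) \<sim>[at_right 0] (\<lambda>x. 1 / x\<^sup>2)"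
    unfolding freq_eigenvalue_def[abs_def] by real_asymp
  from asymp_equiv_compose'[OF this lim]
  have "(\<lambda>s. critical_petals s - c) \<sim>[at_top] (\<lambda>s. 1 / (dirichlet_freq s)\<^sup>2)"
    by (simp add: critical_petals_def Let_def)
  also have "(\<lambda>s. 1 / (dirichlet_freq s)\<^sup>2) = (\<lambda>s. 1 / pi\<^sup>2 * (2 * real s + 1)\<^sup>2)"
    by (simp add: dirichlet_freq_def power_divide)
  also have "(\<lambda>s. 1 / pi\<^sup>2 * (2 * real s + 1)\<^sup>2) \<sim>[at_top] (\<lambda>s. 1 / pi\<^sup>2 * (4 * (real s)\<^sup>2))"
  proof (rule asymp_equiv_mult[OF asymp_equiv_refl])
    show "(\<lambda>s. (2 * real s + 1)\<^sup>2) \<sim>[at_top] (\<lambda>s. 4 * (real s)\<^sup>2)" by real_asymp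
  qed
  finally show ?thesis by simp
qed

theorem theorem2:
  shows "\<exists>f\<^sub>m f\<^sub>M :: nat \<Rightarrow> nat \<Rightarrow> real.
    (\<forall>s\<ge>3. \<forall>t\<ge>3. \<forall>p\<ge>1.
       (real p \<le> f\<^sub>m s t \<longrightarrow> FED (rose_tree s t p)) \<and>
       (real p > f\<^sub>M s t \<longrightarrow> \<not> FED (rose_tree s t p))) \<and>
    (\<forall>s\<ge>3. f\<^sub>m s s = f\<^sub>M s s) \<and>
    (\<lambda>s. f\<^sub>m s s) \<sim>[at_top] (\<lambda>s. 4 / pi\<^sup>2 * (real s)\<^sup>2) \<and>
    (\<forall>s\<ge>3. bdd_above ((\<lambda>t. f\<^sub>M s t) ` {3..}))"
proof -
  \<comment> \<open>The largest integer strictly below the critical number, so that a weak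
    inequality for integers expresses the strict one.\<close>
  define F where "F s = real_of_int (\<lceil>critical_petals s\<rceil> - 1)" for s
  \<comment> \<open>Off the diagonal the value \<open>0\<close> makes the claim for
    \<open>f\<^sub>m\<close> vacuous because \<open>p \<ge> 1\<close>, and the value of
    \<open>f\<^sub>M\<close> is independent of \<open>t\<close>, as (c) demands.\<close>
  define f\<^sub>m where "f\<^sub>m s t = (if s = t then F s else 0)" for s t
  define f\<^sub>M where "f\<^sub>M s t = (if s = t then F s else 8 * (real s + 1)\<^sup>2)" for s t
  have F: "real p \<le> F s \<longleftrightarrow> real p < critical_petals s" for p s
  proof -
    have "real p \<le> F s \<longleftrightarrow> int p \<le> \<lceil>critical_petals s\<rceil> - 1"
      unfolding F_def by (metis of_int_le_iff of_int_of_nat_eq)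
    also have "\<dots> \<longleftrightarrow> int p < \<lceil>critical_petals s\<rceil>" by linarith
    finally show ?thesis by (simp add: less_ceiling_iff)
  qed
  have F_asymp: "F \<sim>[at_top] (\<lambda>s. 4 / pi\<^sup>2 * (real s)\<^sup>2)"
  \<comment> \<open>The ceiling keeps \<open>F\<close> within one of the critical number, hence the
    shifts \<open>1\<close> and \<open>0\<close> for \<open>c\<close> in
    \<open>critical_petals_asymp\<close>.\<close>
  proof (rule asymp_equiv_sandwich_real)
    show "\<forall>\<^sub>F s in at_top. F s \<in> {critical_petals s - 1..critical_petals s - 0}"
    proof (intro always_eventually allI)
      fix s
      show "F s \<in> {critical_petals s - 1..critical_petals s - 0}"
        using ceiling_correct[of "critical_petals s"] by (auto simp: F_def)
    qed
  qed (rule critical_petals_asymp)+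
  show ?thesis
  proof (rule exI[of _ f\<^sub>m], rule exI[of _ f\<^sub>M], intro conjI allI impI)
    fix s t p :: nat assume st: "3 \<le> s" "3 \<le> t" and p: "1 \<le> p"
    show "FED (rose_tree s t p)" if "real p \<le> f\<^sub>m s t"
      using that FED_symmetric_rose[OF st(1) p] F[of p s] p by (auto simp: f\<^sub>m_def split: if_splits)
    show "\<not> FED (rose_tree s t p)" if "f\<^sub>M s t < real p"
      using that not_FED_symmetric_rose[OF st(1) p] not_FED_asymmetric_rose[OF st] F[of p s]
      by (cases "s = t") (auto simp: f\<^sub>M_def)
  next
    show "(\<lambda>s. f\<^sub>m s s) \<sim>[at_top] (\<lambda>s. 4 / pi\<^sup>2 * (real s)\<^sup>2)"
      using F_asymp by (simp add: f\<^sub>m_def)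
    \<comment> \<open>The maximum accounts for the single diagonal value
      \<open>t = s\<close>.\<close>
    show "bdd_above ((\<lambda>t. f\<^sub>M s t) ` {3..})" for s
      by (rule bdd_aboveI[of _ "max (F s) (8 * (real s + 1)\<^sup>2)"]) (auto simp: f\<^sub>M_def)
  qed (simp add: f\<^sub>m_def f\<^sub>M_def)
qed

end
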